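(* Let $K$ be a field and let $E$ be a graph. If every vertex of $E$ lying on a closed simple path is left infinite and $E$ has no nonzero bounded graph traces, then $\mathrm{sr}(L(E))\le 2$.
   Context: A (directed) graph $E=(E^0,E^1,r,s)$ consists of countable sets $E^0$ (vertices) and $E^1$ (edges) and maps $r,s:E^1\to E^0$ (range and source). All graphs are assumed row-finite: $s^{-1}(v)$ is finite for every $v\in E^0$. A path is a sequence of edges $\mu=(\mu_1,\dots,\mu_n)$ with $r(\mu_i)=s(\mu_{i+1})$; $s(\mu)=s(\mu_1)$, $r(\mu)=r(\mu_n)$; vertices are paths of length $0$. Write $v\ge w$ if there is a path $\mu$ (possibly of length $0$) with $s(\mu)=v$, $r(\mu)=w$. A closed simple path based at $v$ is a path $\mu=(\mu_1,\dots,\mu_n)$, $n\ge1$, with $s(\mu)=r(\mu)=v$ and $s(\mu_i)\ne v$ for $i>1$. A vertex $v$ is left infinite if the set $\{w\in E^0: w\ge v\}$ is infinite. A graph trace on $E$ is a function $g:E^0\to\mathbb{R}^+=[0,\infty)$ such that $g(v)=\sum_{s(e)=v}g(r(e))$ for every $v\in E^0$ with $s^{-1}(v)\ne\emptyset$; it is bounded if $\sum_{v\in E^0}g(v)<\infty$. The Leavitt path algebra $L(E)=L_K(E)$ is the (not necessarily unital) $K$-algebra generated by a set $\{v: v\in E^0\}$ of pairwise orthogonal idempotents together with variables $\{e,e^*: e\in E^1\}$ subject to: $s(e)e=er(e)=e$; $r(e)e^*=e^*s(e)=e^*$; $e^*e'=\delta_{e,e'}r(e)$ for $e,e'\in E^1$;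 $v=\sum_{s(e)=v}ee^*$ for every $v\in E^0$ that emits edges. Stable rank: let $R$ be a ring and $S$ any unital ring containing $R$ as a two-sided ideal. A column vector $b=(b_i)_{i=1}^n$ over $S$ is $R$-unimodular if $b_1-1\in R$, $b_i\in R$ for $i>1$, and there exist $a_1,\dots,a_n$ with $a_1-1\in R$, $a_i\in R$ ($i>1$) and $\sum_{i=1}^n a_ib_i=1$. The stable rank $\mathrm{sr}(R)$ is the least natural number $m\ge 1$ such that for every $R$-unimodular vector $(b_i)_{i=1}^{m+1}$ there exist $v_1,\dots,v_m\in R$ such that $(b_i+v_ib_{m+1})_{i=1}^m$ is $R$-unimodular; $\mathrm{sr}(R)=\infty$ if no such $m$ exists. *)

theory Defs
  imports
    "HOL-Algebra.QuotRing"
    "HOL-Analysis.Infinite_Sum"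
    "HOL-Library.Countable_Set"
    "HOL-Library.Extended_Nat"
    "Graph_Theory.Arc_Walk"
begin

section \<open>Graphs\<close>

text \<open>
  A graph is a multidigraph of the library: the source map is \<open>tail\<close>, the range map is \<open>head\<close>,
  and \<open>out_arcs E v\<close> is the set of edges emitted by \<open>v\<close>.
\<close>

locale row_finite_graph = wf_digraph E for E :: "('v, 'e) pre_digraph" (structure) +
  assumes countable_verts: "countable (verts E)"
    and countable_arcs: "countable (arcs E)"
    and row_finite: "v \<in> verts E \<Longrightarrow> finite (out_arcs E v)"

definition connects_to :: "('v, 'e) pre_digraph \<Rightarrow> 'v \<Rightarrow> 'v \<Rightarrow> bool" where
  "connects_to E v w \<longleftrightarrow> (\<exists>p. pre_digraph.awalk E v p w)"

text \<open>The path may return to its base vertex only at the end; it may repeat other vertices.\<close>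

definition closed_simple_path :: "('v, 'e) pre_digraph \<Rightarrow> 'v \<Rightarrow> 'e list \<Rightarrow> bool" where
  "closed_simple_path E v p \<longleftrightarrow>
     pre_digraph.awalk E v p v \<and> p \<noteq> [] \<and> (\<forall>e \<in> set (tl p). tail E e \<noteq> v)"

definition lies_on_closed_simple_path :: "('v, 'e) pre_digraph \<Rightarrow> 'v \<Rightarrow> bool" where
  "lies_on_closed_simple_path E v \<longleftrightarrow>
     (\<exists>u p. closed_simple_path E u p \<and> v \<in> tail E ` set p)"

definition left_infinite :: "('v, 'e) pre_digraph \<Rightarrow> 'v \<Rightarrow> bool" where
  "left_infinite E v \<longleftrightarrow> infinite {w \<in> verts E. connects_to E w v}"

text \<open>Only the values of \<open>g\<close> on the vertices of \<open>E\<close> are meaningful.\<close>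

definition graph_trace :: "('v, 'e) pre_digraph \<Rightarrow> ('v \<Rightarrow> real) \<Rightarrow> bool" where
  "graph_trace E g \<longleftrightarrow>
     (\<forall>v \<in> verts E. 0 \<le> g v) \<and>
     (\<forall>v \<in> verts E. out_arcs E v \<noteq> {} \<longrightarrow> g v = (\<Sum>e \<in> out_arcs E v. g (head E e)))"

definition bounded_graph_trace :: "('v, 'e) pre_digraph \<Rightarrow> ('v \<Rightarrow> real) \<Rightarrow> bool" where
  "bounded_graph_trace E g \<longleftrightarrow> graph_trace E g \<and> g summable_on verts E"


section \<open>The free algebra\<close>

text \<open>
  The free unital algebra \<open>K\<langle>X\<rangle>\<close> on a set \<open>X\<close> of noncommuting variables: an element is the function
  sending each word to its coefficient, and the product is convolution over all ways
  to split a word in two.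
\<close>

definition free_algebra :: "('k, 'm) ring_scheme \<Rightarrow> 'x set \<Rightarrow> ('x list \<Rightarrow> 'k) ring" where
  "free_algebra K X = \<lparr>
     carrier = {f. (\<forall>w. f w \<in> carrier K) \<and> finite {w. f w \<noteq> \<zero>\<^bsub>K\<^esub>}
                   \<and> {w. f w \<noteq> \<zero>\<^bsub>K\<^esub>} \<subseteq> lists X},
     monoid.mult = (\<lambda>f g w. \<Oplus>\<^bsub>K\<^esub>i \<in> {..length w}. f (take i w) \<otimes>\<^bsub>K\<^esub> g (drop i w)),
     one = (\<lambda>w. if w = [] then \<one>\<^bsub>K\<^esub> else \<zero>\<^bsub>K\<^esub>),
     zero = (\<lambda>w. \<zero>\<^bsub>K\<^esub>),
     add = (\<lambda>f g w. f w \<oplus>\<^bsub>K\<^esub> g w)\<rparr>"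

definition free_var :: "('k, 'm) ring_scheme \<Rightarrow> 'x \<Rightarrow> 'x list \<Rightarrow> 'k" where
  "free_var K x = (\<lambda>w. if w = [x] then \<one>\<^bsub>K\<^esub> else \<zero>\<^bsub>K\<^esub>)"

text \<open>The free not necessarily unital algebra on \<open>X\<close>, as an ideal of the free unital one.\<close>

definition free_algebra_plus :: "('k, 'm) ring_scheme \<Rightarrow> 'x set \<Rightarrow> ('x list \<Rightarrow> 'k) set" where
  "free_algebra_plus K X = {f \<in> carrier (free_algebra K X). f [] = \<zero>\<^bsub>K\<^esub>}"


section \<open>Leavitt path algebras\<close>

datatype ('v, 'e) leavitt_gen = Vertex 'v | Edge 'e | Ghost 'e

definition leavitt_gens :: "('v, 'e) pre_digraph \<Rightarrow> ('v, 'e) leavitt_gen set" where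
  "leavitt_gens E = Vertex ` verts E \<union> Edge ` arcs E \<union> Ghost ` arcs E"

abbreviation leavitt_free ::
  "('k, 'm) ring_scheme \<Rightarrow> ('v, 'e) pre_digraph \<Rightarrow> (('v, 'e) leavitt_gen list \<Rightarrow> 'k) ring" where
  "leavitt_free K E \<equiv> free_algebra K (leavitt_gens E)"

text \<open>The defining relations, each written as an element that has to vanish.\<close>

definition leavitt_relations ::
  "('k, 'm) ring_scheme \<Rightarrow> ('v, 'e) pre_digraph \<Rightarrow> (('v, 'e) leavitt_gen list \<Rightarrow> 'k) set" where
  "leavitt_relations K E =
    (let F = leavitt_free K E;
         V = (\<lambda>v. free_var K (Vertex v));
         D = (\<lambda>e. free_var K (Edge e));
         G = (\<lambda>e. free_var K (Ghost e))
     in {V v \<otimes>\<^bsub>F\<^esub> V v \<ominus>\<^bsub>F\<^esub> V v | v. v \<in> verts E}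
      \<union> {V v \<otimes>\<^bsub>F\<^esub> V w | v w. v \<in> verts E \<and> w \<in> verts E \<and> v \<noteq> w}
      \<union> {V (tail E e) \<otimes>\<^bsub>F\<^esub> D e \<ominus>\<^bsub>F\<^esub> D e | e. e \<in> arcs E}
      \<union> {D e \<otimes>\<^bsub>F\<^esub> V (head E e) \<ominus>\<^bsub>F\<^esub> D e | e. e \<in> arcs E}
      \<union> {V (head E e) \<otimes>\<^bsub>F\<^esub> G e \<ominus>\<^bsub>F\<^esub> G e | e. e \<in> arcs E}
      \<union> {G e \<otimes>\<^bsub>F\<^esub> V (tail E e) \<ominus>\<^bsub>F\<^esub> G e | e. e \<in> arcs E}
      \<union> {G e \<otimes>\<^bsub>F\<^esub> D e \<ominus>\<^bsub>F\<^esub> V (head E e) | e. e \<in> arcs E}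
      \<union> {G e \<otimes>\<^bsub>F\<^esub> D f | e f. e \<in> arcs E \<and> f \<in> arcs E \<and> e \<noteq> f}
      \<union> {V v \<ominus>\<^bsub>F\<^esub> (\<Oplus>\<^bsub>F\<^esub>e \<in> out_arcs E v. D e \<otimes>\<^bsub>F\<^esub> G e)
          | v. v \<in> verts E \<and> out_arcs E v \<noteq> {}})"

text \<open>
  The quotient of the free unital algebra by the two-sided ideal generated by the relations is
  the unitization \<open>K \<oplus> L(E)\<close>. The relations lie in the free nonunital algebra, and the ideal which
  they generate in the free unital algebra is the algebra ideal which they generate in the nonunital one.
\<close>

definition leavitt_ideal ::
  "('k, 'm) ring_scheme \<Rightarrow> ('v, 'e) pre_digraph \<Rightarrow> (('v, 'e) leavitt_gen list \<Rightarrow> 'k) set" where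
  "leavitt_ideal K E = genideal (leavitt_free K E) (leavitt_relations K E)"

definition leavitt_unitization ::
  "('k, 'm) ring_scheme \<Rightarrow> ('v, 'e) pre_digraph \<Rightarrow> (('v, 'e) leavitt_gen list \<Rightarrow> 'k) set ring" where
  "leavitt_unitization K E = leavitt_free K E Quot leavitt_ideal K E"

text \<open>
  \<open>L(E)\<close> is the image of the free nonunital algebra, with the operations of the unitization.
  It need not have a unit: the \<open>one\<close> field of the record is that of the unitization,
  in general not an element of the carrier, and is never to be used.
\<close>

definition leavitt_path_algebra ::
  "('k, 'm) ring_scheme \<Rightarrow> ('v, 'e) pre_digraph \<Rightarrow> (('v, 'e) leavitt_gen list \<Rightarrow> 'k) set ring" where
  "leavitt_path_algebra K E = (leavitt_unitization K E)
     \<lparr>carrier := (\<lambda>f. leavitt_ideal K E +>\<^bsub>leavitt_free K E\<^esub> f)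
                   ` free_algebra_plus K (leavitt_gens E)\<rparr>"


section \<open>Stable rank\<close>

text \<open>
  Here \<open>S\<close> is a unital ring and \<open>R\<close> a two-sided ideal of \<open>S\<close>. Vectors are indexed by \<open>{1..n}\<close>.
\<close>

definition rel_unital_vector :: "('s, 'm) ring_scheme \<Rightarrow> 's set \<Rightarrow> nat \<Rightarrow> (nat \<Rightarrow> 's) \<Rightarrow> bool" where
  "rel_unital_vector S R n b \<longleftrightarrow>
     (\<forall>i \<in> {1..n}. b i \<in> carrier S) \<and> b 1 \<ominus>\<^bsub>S\<^esub> \<one>\<^bsub>S\<^esub> \<in> R \<and> (\<forall>i \<in> {2..n}. b i \<in> R)"

definition rel_unimodular :: "('s, 'm) ring_scheme \<Rightarrow> 's set \<Rightarrow> nat \<Rightarrow> (nat \<Rightarrow> 's) \<Rightarrow> bool" where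
  "rel_unimodular S R n b \<longleftrightarrow>
     rel_unital_vector S R n b \<and>
     (\<exists>a. rel_unital_vector S R n a \<and> (\<Oplus>\<^bsub>S\<^esub>i \<in> {1..n}. a i \<otimes>\<^bsub>S\<^esub> b i) = \<one>\<^bsub>S\<^esub>)"

definition in_stable_range :: "('s, 'm) ring_scheme \<Rightarrow> 's set \<Rightarrow> nat \<Rightarrow> bool" where
  "in_stable_range S R m \<longleftrightarrow>
     (\<forall>b. rel_unimodular S R (m + 1) b \<longrightarrow>
       (\<exists>v. (\<forall>i \<in> {1..m}. v i \<in> R) \<and>
            rel_unimodular S R m (\<lambda>i. b i \<oplus>\<^bsub>S\<^esub> v i \<otimes>\<^bsub>S\<^esub> b (m + 1))))"

text \<open>The infimum of the empty set in \<open>enat\<close> is \<open>\<infinity>\<close>.\<close>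

definition stable_rank :: "('s, 'm) ring_scheme \<Rightarrow> 's set \<Rightarrow> enat" where
  "stable_rank S R = Inf {enat m | m. 1 \<le> m \<and> in_stable_range S R m}"

text \<open>
  \<open>embeds_as_ideal R S \<phi>\<close>: the map \<open>\<phi>\<close> identifies the not necessarily unital ring \<open>R\<close> with a
  two-sided ideal of the unital ring \<open>S\<close>. (Membership in \<open>hom\<close> does not involve units, and
  \<open>ideal\<close> includes that \<open>S\<close> is a ring.)
\<close>

definition embeds_as_ideal ::
  "('r, 'm) ring_scheme \<Rightarrow> ('s, 'n) ring_scheme \<Rightarrow> ('r \<Rightarrow> 's) \<Rightarrow> bool" where
  "embeds_as_ideal R S \<phi> \<longleftrightarrow>
     \<phi> \<in> hom (add_monoid R) (add_monoid S) \<and> \<phi> \<in> hom R S \<and>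
     inj_on \<phi> (carrier R) \<and> ideal (\<phi> ` carrier R) S"


section \<open>The unitization contains the Leavitt path algebra as an ideal\<close>

lemma free_algebra_simps:
  "f \<in> carrier (free_algebra K X) \<longleftrightarrow>
     (\<forall>w. f w \<in> carrier K) \<and> finite {w. f w \<noteq> \<zero>\<^bsub>K\<^esub>} \<and> {w. f w \<noteq> \<zero>\<^bsub>K\<^esub>} \<subseteq> lists X"
  "(f \<otimes>\<^bsub>free_algebra K X\<^esub> g) w =
     (\<Oplus>\<^bsub>K\<^esub>i \<in> {..length w}. f (take i w) \<otimes>\<^bsub>K\<^esub> g (drop i w))"
  "\<one>\<^bsub>free_algebra K X\<^esub> w = (if w = [] then \<one>\<^bsub>K\<^esub> else \<zero>\<^bsub>K\<^esub>)"
  "\<zero>\<^bsub>free_algebra K X\<^esub> w = \<zero>\<^bsub>K\<^esub>"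
  "(f \<oplus>\<^bsub>free_algebra K X\<^esub> g) w = f w \<oplus>\<^bsub>K\<^esub> g w"
  by (simp_all add: free_algebra_def)

context ring
begin

definition conv :: "('x list \<Rightarrow> 'a) \<Rightarrow> ('x list \<Rightarrow> 'a) \<Rightarrow> 'x list \<Rightarrow> 'a" where
  "conv f g w = (\<Oplus>i \<in> {..length w}. f (take i w) \<otimes> g (drop i w))"

lemma conv_closed [simp]:
  assumes "\<And>w. f w \<in> carrier R" "\<And>w. g w \<in> carrier R"
  shows "conv f g w \<in> carrier R"
  unfolding conv_def using assms by (intro finsum_closed) auto

lemma conv_Nil [simp]:
  assumes "\<And>w. f w \<in> carrier R" "\<And>w. g w \<in> carrier R"
  shows "conv f g [] = f [] \<otimes> g []"
  using assms by (simp add: conv_def)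

lemma conv_Cons:
  assumes "\<And>w. f w \<in> carrier R" "\<And>w. g w \<in> carrier R"
  shows "conv f g (x # w) = f [] \<otimes> g (x # w) \<oplus> conv (\<lambda>u. f (x # u)) g w"
proof -
  have "conv f g (x # w) =
     (\<Oplus>i \<in> {..length w}. f (take (Suc i) (x # w)) \<otimes> g (drop (Suc i) (x # w)))
       \<oplus> f (take 0 (x # w)) \<otimes> g (drop 0 (x # w))"
    unfolding conv_def length_Cons using assms by (subst finsum_Suc2) auto
  also have "\<dots> = f [] \<otimes> g (x # w) \<oplus> conv (\<lambda>u. f (x # u)) g w"
    unfolding conv_def using assms by (subst a_comm) (auto intro!: finsum_closed)
  finally show ?thesis .
qed

lemma conv_add_left:
  assumes "\<And>w. f w \<in> carrier R" "\<And>w. g w \<in> carrier R" "\<And>w. h w \<in> carrier R"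
  shows "conv (\<lambda>w. f w \<oplus> g w) h w = conv f h w \<oplus> conv g h w"
  unfolding conv_def using assms
  by (subst finsum_addf [symmetric]) (auto simp: l_distr intro!: finsum_cong')

lemma conv_add_right:
  assumes "\<And>w. f w \<in> carrier R" "\<And>w. g w \<in> carrier R" "\<And>w. h w \<in> carrier R"
  shows "conv h (\<lambda>w. f w \<oplus> g w) w = conv h f w \<oplus> conv h g w"
  unfolding conv_def using assms
  by (subst finsum_addf [symmetric]) (auto simp: r_distr intro!: finsum_cong')

lemma conv_smult:
  assumes "\<And>w. f w \<in> carrier R" "\<And>w. g w \<in> carrier R" "c \<in> carrier R"
  shows "conv (\<lambda>w. c \<otimes> f w) g w = c \<otimes> conv f g w"
  unfolding conv_def using assms
  by (subst finsum_rdistr) (auto simp: m_assoc intro!: finsum_cong')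

lemma conv_assoc:
  assumes "\<And>w. f w \<in> carrier R" "\<And>w. g w \<in> carrier R" "\<And>w. h w \<in> carrier R"
  shows "conv (conv f g) h w = conv f (conv g h) w"
  using assms
proof (induction w arbitrary: f g)
  case Nil
  then show ?case by (simp add: m_assoc)
next
  case (Cons x w)
  note [simp] = Cons.prems
  have "conv (conv f g) h (x # w) = (f [] \<otimes> g []) \<otimes> h (x # w)
      \<oplus> conv (\<lambda>u. f [] \<otimes> g (x # u) \<oplus> conv (\<lambda>u. f (x # u)) g u) h w"
    by (simp add: conv_Cons)
  also have "\<dots> = (f [] \<otimes> g []) \<otimes> h (x # w) \<oplus>
      (f [] \<otimes> conv (\<lambda>u. g (x # u)) h w \<oplus> conv (conv (\<lambda>u. f (x # u)) g) h w)"
    by (simp add: conv_add_left conv_smult)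
  also have "conv (conv (\<lambda>u. f (x # u)) g) h w = conv (\<lambda>u. f (x # u)) (conv g h) w"
    by (rule Cons.IH) simp_all
  also have "(f [] \<otimes> g []) \<otimes> h (x # w) \<oplus>
      (f [] \<otimes> conv (\<lambda>u. g (x # u)) h w \<oplus> conv (\<lambda>u. f (x # u)) (conv g h) w)
      = f [] \<otimes> conv g h (x # w) \<oplus> conv (\<lambda>u. f (x # u)) (conv g h) w"
    by (simp add: conv_Cons r_distr m_assoc a_assoc)
  also have "\<dots> = conv f (conv g h) (x # w)"
    by (simp add: conv_Cons)
  finally show ?case .
qed

lemma conv_zero_left: "(\<And>w. g w \<in> carrier R) \<Longrightarrow> conv (\<lambda>w. \<zero>) g w = \<zero>"
  unfolding conv_def by (subst finsum_cong' [where g = "\<lambda>_. \<zero>" and B = "{..length w}"]) auto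

lemma conv_one_left:
  assumes "\<And>w. g w \<in> carrier R"
  shows "conv (\<lambda>w. if w = [] then \<one> else \<zero>) g w = g w"
  using assms by (cases w) (simp_all add: conv_Cons conv_zero_left)

lemma conv_one_right:
  assumes "\<And>w. f w \<in> carrier R"
  shows "conv f (\<lambda>w. if w = [] then \<one> else \<zero>) w = f w"
  using assms by (induction w arbitrary: f) (simp_all add: conv_Cons)

lemma conv_support:
  assumes "\<And>w. f w \<in> carrier R" "\<And>w. g w \<in> carrier R"
  shows "{w. conv f g w \<noteq> \<zero>} \<subseteq> (\<lambda>(u, v). u @ v) ` ({u. f u \<noteq> \<zero>} \<times> {v. g v \<noteq> \<zero>})"
proof
  fix w assume w: "w \<in> {w. conv f g w \<noteq> \<zero>}"
  have "\<exists>i \<in> {..length w}. f (take i w) \<otimes> g (drop i w) \<noteq> \<zero>"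
  proof (rule ccontr)
    assume "\<not> ?thesis"
    then have "conv f g w = (\<Oplus>i \<in> {..length w}. \<zero>)"
      unfolding conv_def by (intro finsum_cong') auto
    with w show False by simp
  qed
  then obtain i where "f (take i w) \<otimes> g (drop i w) \<noteq> \<zero>" by blast
  then have "f (take i w) \<noteq> \<zero>" "g (drop i w) \<noteq> \<zero>" using assms by auto
  then show "w \<in> (\<lambda>(u, v). u @ v) ` ({u. f u \<noteq> \<zero>} \<times> {v. g v \<noteq> \<zero>})"
    by (intro image_eqI [where x = "(take i w, drop i w)"]) auto
qed

lemma free_algebra_mult:
  "f \<otimes>\<^bsub>free_algebra R X\<^esub> g = conv f g"
  by (rule ext) (simp add: free_algebra_simps conv_def)

lemma free_algebra_mult_closed:
  assumes "f \<in> carrier (free_algebra R X)" "g \<in> carrier (free_algebra R X)"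
  shows "conv f g \<in> carrier (free_algebra R X)"
proof -
  have c: "\<And>w. f w \<in> carrier R" "\<And>w. g w \<in> carrier R"
    using assms by (auto simp: free_algebra_simps)
  note s = conv_support [of f g, OF c]
  have "finite ((\<lambda>(u, v). u @ v) ` ({u. f u \<noteq> \<zero>} \<times> {v. g v \<noteq> \<zero>}))"
    using assms by (auto simp: free_algebra_simps)
  moreover have "(\<lambda>(u, v). u @ v) ` ({u. f u \<noteq> \<zero>} \<times> {v. g v \<noteq> \<zero>}) \<subseteq> lists X"
  proof
    fix w assume "w \<in> (\<lambda>(u, v). u @ v) ` ({u. f u \<noteq> \<zero>} \<times> {v. g v \<noteq> \<zero>})"
    then obtain u v where uv: "f u \<noteq> \<zero>" "g v \<noteq> \<zero>" and w: "w = u @ v" by auto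
    have "u \<in> lists X" "v \<in> lists X"
      using uv assms unfolding free_algebra_simps(1) by blast+
    then show "w \<in> lists X" by (simp add: w)
  qed
  ultimately have "finite {w. conv f g w \<noteq> \<zero>}" "{w. conv f g w \<noteq> \<zero>} \<subseteq> lists X"
    using finite_subset [OF s] subset_trans [OF s] by simp_all
  then show ?thesis
    unfolding free_algebra_simps(1) by (intro conjI allI conv_closed c)
qed

lemma ring_free_algebra: "ring (free_algebra R X)"
proof (rule ringI)
  show "abelian_group (free_algebra R X)"
  proof (rule abelian_groupI)
    fix f g assume fg: "f \<in> carrier (free_algebra R X)" "g \<in> carrier (free_algebra R X)"
    have "{w. f w \<oplus> g w \<noteq> \<zero>} \<subseteq> {w. f w \<noteq> \<zero>} \<union> {w. g w \<noteq> \<zero>}" by auto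
    moreover have "finite ({w. f w \<noteq> \<zero>} \<union> {w. g w \<noteq> \<zero>})"
      "{w. f w \<noteq> \<zero>} \<union> {w. g w \<noteq> \<zero>} \<subseteq> lists X"
      using fg unfolding free_algebra_simps(1) by blast+
    moreover have "f w \<oplus> g w \<in> carrier R" for w using fg by (simp add: free_algebra_simps)
    ultimately show "f \<oplus>\<^bsub>free_algebra R X\<^esub> g \<in> carrier (free_algebra R X)"
      unfolding free_algebra_simps by (blast intro: finite_subset)
  next
    fix f assume f: "f \<in> carrier (free_algebra R X)"
    let ?g = "\<lambda>w. \<ominus> f w"
    have eq: "\<ominus> f w = \<zero> \<longleftrightarrow> f w = \<zero>" for w
      using f by (metis free_algebra_simps(1) minus_minus minus_zero)
    show "\<exists>g \<in> carrier (free_algebra R X).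
            g \<oplus>\<^bsub>free_algebra R X\<^esub> f = \<zero>\<^bsub>free_algebra R X\<^esub>"
    proof (rule bexI [where x = ?g])
      show "?g \<in> carrier (free_algebra R X)" using f by (auto simp: free_algebra_simps eq)
    qed (use f in \<open>auto simp: free_algebra_simps l_neg\<close>)
  qed (auto simp: free_algebra_simps fun_eq_iff intro: a_assoc a_comm)
  show "monoid (free_algebra R X)"
  proof (rule monoidI)
    fix f g h
    assume "f \<in> carrier (free_algebra R X)" "g \<in> carrier (free_algebra R X)"
      "h \<in> carrier (free_algebra R X)"
    then show "f \<otimes>\<^bsub>free_algebra R X\<^esub> g \<otimes>\<^bsub>free_algebra R X\<^esub> h =
        f \<otimes>\<^bsub>free_algebra R X\<^esub> (g \<otimes>\<^bsub>free_algebra R X\<^esub> h)"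
      unfolding free_algebra_mult by (intro ext conv_assoc) (auto simp: free_algebra_simps)
  next
    fix f assume "f \<in> carrier (free_algebra R X)"
    then have f: "\<And>w. f w \<in> carrier R" by (simp add: free_algebra_simps)
    have one: "\<one>\<^bsub>free_algebra R X\<^esub> = (\<lambda>w. if w = [] then \<one> else \<zero>)"
      by (simp add: free_algebra_def)
    show "\<one>\<^bsub>free_algebra R X\<^esub> \<otimes>\<^bsub>free_algebra R X\<^esub> f = f"
      unfolding free_algebra_mult one using f by (intro ext conv_one_left)
    show "f \<otimes>\<^bsub>free_algebra R X\<^esub> \<one>\<^bsub>free_algebra R X\<^esub> = f"
      unfolding free_algebra_mult one using f by (intro ext conv_one_right)
  next
    fix f g assume "f \<in> carrier (free_algebra R X)" "g \<in> carrier (free_algebra R X)"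
    then show "f \<otimes>\<^bsub>free_algebra R X\<^esub> g \<in> carrier (free_algebra R X)"
      unfolding free_algebra_mult by (rule free_algebra_mult_closed)
  next
    have "finite {w. (if w = [] then \<one> else \<zero>) \<noteq> \<zero>}"
      by (rule finite_subset [where B = "{[]}"]) (auto split: if_splits)
    then show "\<one>\<^bsub>free_algebra R X\<^esub> \<in> carrier (free_algebra R X)"
      by (auto simp: free_algebra_simps split: if_splits)
  qed
next
  fix f g h
  assume "f \<in> carrier (free_algebra R X)" "g \<in> carrier (free_algebra R X)"
    "h \<in> carrier (free_algebra R X)"
  then have c: "\<And>w. f w \<in> carrier R" "\<And>w. g w \<in> carrier R" "\<And>w. h w \<in> carrier R"
    by (simp_all add: free_algebra_simps)
  have add: "p \<oplus>\<^bsub>free_algebra R X\<^esub> q = (\<lambda>w. p w \<oplus> q w)" for p q :: "_ list \<Rightarrow> 'a"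
    by (rule ext) (simp add: free_algebra_simps)
  show "(f \<oplus>\<^bsub>free_algebra R X\<^esub> g) \<otimes>\<^bsub>free_algebra R X\<^esub> h =
      f \<otimes>\<^bsub>free_algebra R X\<^esub> h \<oplus>\<^bsub>free_algebra R X\<^esub> g \<otimes>\<^bsub>free_algebra R X\<^esub> h"
    unfolding free_algebra_mult add using c by (intro ext conv_add_left)
  show "h \<otimes>\<^bsub>free_algebra R X\<^esub> (f \<oplus>\<^bsub>free_algebra R X\<^esub> g) =
      h \<otimes>\<^bsub>free_algebra R X\<^esub> f \<oplus>\<^bsub>free_algebra R X\<^esub> h \<otimes>\<^bsub>free_algebra R X\<^esub> g"
    unfolding free_algebra_mult add using c by (intro ext conv_add_right)
qed

lemma ideal_free_algebra_plus: "ideal (free_algebra_plus R X) (free_algebra R X)"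
proof -
  interpret F: ring "free_algebra R X" by (rule ring_free_algebra)
  have c: "f w \<in> carrier R" if "f \<in> carrier (free_algebra R X)" for f w
    using that by (simp add: free_algebra_simps)
  have neg: "(\<ominus>\<^bsub>free_algebra R X\<^esub> f) [] = \<zero>"
    if "f \<in> carrier (free_algebra R X)" "f [] = \<zero>" for f
  proof -
    have "(\<ominus>\<^bsub>free_algebra R X\<^esub> f \<oplus>\<^bsub>free_algebra R X\<^esub> f) [] = \<zero>"
      using that by (simp add: F.l_neg free_algebra_simps)
    then show ?thesis
      using that c [OF F.a_inv_closed [OF that(1)]] by (simp add: free_algebra_simps)
  qed
  show ?thesis
  proof (rule idealI)
    show "ring (free_algebra R X)" by (rule ring_free_algebra)
    show "subgroup (free_algebra_plus R X) (add_monoid (free_algebra R X))"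
    proof (rule F.add.subgroupI)
      show "free_algebra_plus R X \<noteq> {}"
        using F.zero_closed by (auto simp: free_algebra_plus_def free_algebra_simps(4))
    next
      fix f assume "f \<in> free_algebra_plus R X"
      then show "\<ominus>\<^bsub>free_algebra R X\<^esub> f \<in> free_algebra_plus R X"
        by (auto simp: free_algebra_plus_def neg)
    next
      fix f g assume "f \<in> free_algebra_plus R X" "g \<in> free_algebra_plus R X"
      then show "f \<oplus>\<^bsub>free_algebra R X\<^esub> g \<in> free_algebra_plus R X"
        by (auto simp: free_algebra_plus_def free_algebra_simps(5))
    qed (auto simp: free_algebra_plus_def)
  next
    fix f g assume "f \<in> free_algebra_plus R X" "g \<in> carrier (free_algebra R X)"
    then have *: "f \<in> carrier (free_algebra R X)" "f [] = \<zero>" "g \<in> carrier (free_algebra R X)"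
      by (auto simp: free_algebra_plus_def)
    have "conv g f [] = \<zero>" "conv f g [] = \<zero>" using * c by auto
    then show "g \<otimes>\<^bsub>free_algebra R X\<^esub> f \<in> free_algebra_plus R X"
      "f \<otimes>\<^bsub>free_algebra R X\<^esub> g \<in> free_algebra_plus R X"
      using F.m_closed [OF *(1) *(3)] F.m_closed [OF *(3) *(1)]
      by (simp_all add: free_algebra_plus_def free_algebra_mult)
  qed
qed

end

lemma free_var_closed:
  assumes "field K" "x \<in> X"
  shows "free_var K x \<in> carrier (free_algebra K X)"
proof -
  interpret field K by fact
  have "finite {w. free_var K x w \<noteq> \<zero>\<^bsub>K\<^esub>}"
    by (rule finite_subset [where B = "{[x]}"]) (auto simp: free_var_def)
  then show ?thesis
    using assms(2) by (auto simp: free_algebra_simps free_var_def split: if_splits)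
qed

lemma leavitt_relations_subset:
  assumes "field K" "wf_digraph E"
  shows "leavitt_relations K E \<subseteq> carrier (leavitt_free K E)"
proof -
  interpret field K by fact
  interpret F: ring "leavitt_free K E" by (rule ring_free_algebra)
  interpret wf_digraph E by fact
  have [simp]: "v \<in> verts E \<Longrightarrow> free_var K (Vertex v) \<in> carrier (leavitt_free K E)"
    "e \<in> arcs E \<Longrightarrow> free_var K (Edge e) \<in> carrier (leavitt_free K E)"
    "e \<in> arcs E \<Longrightarrow> free_var K (Ghost e) \<in> carrier (leavitt_free K E)" for v e
    by (auto intro!: free_var_closed assms simp: leavitt_gens_def)
  have [simp]: "(\<Oplus>\<^bsub>leavitt_free K E\<^esub>e \<in> out_arcs E v.
      free_var K (Edge e) \<otimes>\<^bsub>leavitt_free K E\<^esub> free_var K (Ghost e)) \<in> carrier (leavitt_free K E)" for v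
    by (rule F.finsum_closed) (auto simp: out_arcs_def)
  show ?thesis
    unfolding leavitt_relations_def Let_def by auto
qed

lemma embeds_leavitt_unitization:
  assumes "field K" "wf_digraph E"
  shows "embeds_as_ideal (leavitt_path_algebra K E) (leavitt_unitization K E) (\<lambda>x. x)"
proof -
  interpret field K by fact
  interpret F: ring "leavitt_free K E" by (rule ring_free_algebra)
  have I: "ideal (leavitt_ideal K E) (leavitt_free K E)"
    unfolding leavitt_ideal_def by (intro F.genideal_ideal leavitt_relations_subset assms)
  let ?S = "leavitt_unitization K E"
  let ?q = "\<lambda>f. leavitt_ideal K E +>\<^bsub>leavitt_free K E\<^esub> f"
  have ideal: "ideal (?q ` free_algebra_plus K (leavitt_gens E)) ?S"
    unfolding leavitt_unitization_def
    by (rule F.ring_ideal_imp_quot_ideal [OF I ideal_free_algebra_plus])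
  then have "?q ` free_algebra_plus K (leavitt_gens E) \<subseteq> carrier ?S"
    by (rule ideal.Icarr [THEN subsetI])
  with ideal show ?thesis
    by (auto simp: embeds_as_ideal_def leavitt_path_algebra_def hom_def)
qed

end

theory Submission
  imports Defs "HOL-Analysis.Function_Topology"
begin

text \<open>
  The Leavitt path algebra \<open>L(E)\<close> has plenty of room under these hypotheses: for every finite set \<open>V\<close> of
  vertices with sum \<open>p\<close> there are \<open>x\<close> and \<open>y\<close> in \<open>L(E)\<close> with \<open>x y = p\<close> and \<open>x p = p y = 0\<close>
  (\<open>vertex_sum_orthogonal_copy\<close>), so \<open>p\<close> is equivalent to an idempotent orthogonal to it. Since such sums
  are local units (\<open>leavitt_left_units\<close>), every vector of length 3 can be shortened: the last entry is
  moved by \<open>y\<close> into a place orthogonal to the second one and is recovered by \<open>x\<close>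
  (\<open>in_stable_range_2_if_orthogonal_copies\<close>). This argument takes place inside the ideal, hence gives the same
  bound for every unital ring that contains \<open>L(E)\<close> as an ideal.

  The elements \<open>x\<close> and \<open>y\<close> come from paths. Expanding the vertices of \<open>V\<close> by the relation
  \<open>v = \<Sum> e e\<^sup>*\<close> writes \<open>p\<close> as a sum \<open>\<Sum> \<mu> \<mu>\<^sup>*\<close> over finitely many paths, and it suffices to
  replace each \<open>\<mu>\<close> by a path \<open>\<nu>\<close> with the same range that starts outside \<open>V\<close>, in such a way that the
  paths \<open>\<nu>\<close> are pairwise incomparable; then \<open>x = \<Sum> \<mu> \<nu>\<^sup>*\<close> and \<open>y = \<Sum> \<nu> \<mu>\<^sup>*\<close>.
  If the range of \<open>\<mu>\<close> is left infinite, infinitely many starting vertices are available for \<open>\<nu>\<close>. The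
  vertices that are not left infinite lie on no nontrivial closed walk, so that within a finite set \<open>Y\<close> of them every
  expansion terminates. Here the paths \<open>\<nu>\<close> are taken from the expansions of the vertices in \<open>Y - V\<close>.
  If for every \<open>Y\<close> there were too few of them for some range \<open>u\<close>, then counting the paths to \<open>u\<close> and
  normalizing would give functions of total mass 1 on \<open>Y\<close>, with more than half of the mass on \<open>V\<close>,
  that satisfy the trace equation on \<open>Y\<close>. By compactness there would be a function satisfying the
  trace equation everywhere, with total mass at most 1 and mass at least 1/2 on \<open>V\<close>: a nonzero bounded
  graph trace (\<open>exit_paths_dominated\<close>).
\<close>

section \<open>Paths leaving a finite set of vertices\<close>

text \<open>
  The paths followed from \<open>v\<close> up to the first vertex outside \<open>X\<close>; for \<open>v\<close> itself outside \<open>X\<close>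
  this leaves only the trivial path. If all vertices of \<open>X\<close> emit edges, these paths index the summands
  obtained from \<open>v\<close> by applying the relation \<open>u = \<Sum> e e\<^sup>*\<close> as long as possible at the vertices
  \<open>u\<close> of \<open>X\<close>.
\<close>

definition exit_paths :: "('v, 'e) pre_digraph \<Rightarrow> 'v set \<Rightarrow> 'v \<Rightarrow> 'e list set" where
  "exit_paths E X v =
     {p. \<exists>w. pre_digraph.awalk E v p w \<and> w \<notin> X \<and> tail E ` set p \<subseteq> X}"

definition exit_count :: "('v, 'e) pre_digraph \<Rightarrow> 'v set \<Rightarrow> 'v \<Rightarrow> 'v \<Rightarrow> nat" where
  "exit_count E X v u = card {p \<in> exit_paths E X v. pre_digraph.awalk E v p u}"

definition acyclic_on :: "('v, 'e) pre_digraph \<Rightarrow> 'v set \<Rightarrow> bool" where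
  "acyclic_on E X \<longleftrightarrow> (\<forall>v \<in> X. \<forall>p. pre_digraph.awalk E v p v \<longrightarrow> p = [])"

context row_finite_graph
begin

lemma exit_paths_outside:
  assumes "v \<in> verts E" "v \<notin> X"
  shows "exit_paths E X v = {[]}"
proof -
  have "p = []" if "p \<in> exit_paths E X v" for p
    using that assms by (cases p) (auto simp: exit_paths_def awalk_Cons_iff)
  moreover have "[] \<in> exit_paths E X v"
    using assms by (auto simp: exit_paths_def awalk_Nil_iff)
  ultimately show ?thesis by blast
qed

lemma exit_paths_inside:
  assumes "v \<in> X"
  shows "exit_paths E X v = (\<Union>e \<in> out_arcs E v. (#) e ` exit_paths E X (head E e))"
proof (intro equalityI subsetI)
  fix p assume "p \<in> exit_paths E X v"
  then show "p \<in> (\<Union>e \<in> out_arcs E v. (#) e ` exit_paths E X (head E e))"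
    using assms by (cases p) (auto simp: exit_paths_def awalk_simps intro!: bexI imageI)
next
  fix p assume "p \<in> (\<Union>e \<in> out_arcs E v. (#) e ` exit_paths E X (head E e))"
  then show "p \<in> exit_paths E X v"
    using assms by (auto simp: exit_paths_def awalk_simps)
qed

text \<open>A proper extension of an exit path would have to leave from a vertex outside \<open>X\<close>.\<close>

lemma exit_paths_prefix_free:
  assumes "p \<in> exit_paths E X v" "p @ q \<in> exit_paths E X v"
  shows "q = []"
  using assms by (cases q) (auto simp: exit_paths_def awalk_simps)

lemma walk_if_successor_chain:
  assumes "(u, v) \<in> {(head E e, tail E e) | e. e \<in> arcs E \<and> tail E e \<in> X \<and> head E e \<in> X}\<^sup>+"
  shows "\<exists>p. p \<noteq> [] \<and> awalk v p u"
  using assms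
proof (induction rule: trancl_induct)
  case (base y)
  then obtain e where "e \<in> arcs E" "u = head E e" "y = tail E e" by auto
  then show ?case by (intro exI [of _ "[e]"]) (auto simp: awalk_simps)
next
  case (step y z)
  then obtain p e where "p \<noteq> []" "awalk y p u" "e \<in> arcs E" "y = head E e" "z = tail E e"
    by auto
  then show ?case by (intro exI [of _ "e # p"]) (auto simp: awalk_simps)
qed

text \<open>
  A vertex of \<open>X\<close> may be treated after the ranges of its edges: a finite set without nontrivial closed walks
  is exhausted after finitely many steps along edges.
\<close>

lemma acyclic_on_induct [consumes 3, case_names outside inside]:
  assumes X: "finite X" "acyclic_on E X" and v: "v \<in> verts E"
    and outside: "\<And>v. v \<in> verts E \<Longrightarrow> v \<notin> X \<Longrightarrow> P v"
    and inside: "\<And>v. v \<in> verts E \<Longrightarrow> v \<in> X \<Longrightarrow> (\<And>e. e \<in> out_arcs E v \<Longrightarrow> P (head E e)) \<Longrightarrow> P v"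
  shows "P v"
proof -
  define r where "r = {(head E e, tail E e) | e. e \<in> arcs E \<and> tail E e \<in> X \<and> head E e \<in> X}"
  have "r \<subseteq> X \<times> X" by (auto simp: r_def)
  then have "finite r" using X(1) by (auto intro: finite_subset)
  moreover have "acyclic r"
    unfolding acyclic_def
  proof (intro allI notI)
    fix x assume x: "(x, x) \<in> r\<^sup>+"
    then obtain p where "p \<noteq> []" "awalk x p x"
      using walk_if_successor_chain unfolding r_def by blast
    moreover have "x \<in> X"
      using trancl_subset_Sigma [OF \<open>r \<subseteq> X \<times> X\<close>] x by blast
    ultimately show False using X(2) by (auto simp: acyclic_on_def)
  qed
  ultimately have "wf r" by (rule finite_acyclic_wf)
  then show ?thesis using v
  proof (induction v rule: wf_induct_rule)
    case (less v)
    show ?case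
    proof (cases "v \<in> X")
      case True
      show ?thesis
      proof (rule inside [OF less.prems True])
        fix e assume e: "e \<in> out_arcs E v"
        then have "head E e \<in> verts E" by auto
        then show "P (head E e)"
        proof (cases "head E e \<in> X")
          case True
          then have "(head E e, v) \<in> r" using e \<open>v \<in> X\<close> by (auto simp: r_def)
          then show ?thesis using less.IH \<open>head E e \<in> verts E\<close> by blast
        qed (use outside \<open>head E e \<in> verts E\<close> in blast)
      qed
    qed (use less.prems outside in blast)
  qed
qed

lemma finite_exit_paths:
  assumes "finite X" "acyclic_on E X" "v \<in> verts E"
  shows "finite (exit_paths E X v)"
  using assms
  by (induction v rule: acyclic_on_induct)
    (simp_all add: exit_paths_outside exit_paths_inside row_finite)

lemma exit_count_outside:
  assumes "v \<in> verts E" "v \<notin> X"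
  shows "exit_count E X v u = (if v = u then 1 else 0)"
proof -
  have "{p \<in> exit_paths E X v. awalk v p u} = (if v = u then {[]} else {})"
    using assms by (auto simp: exit_paths_outside awalk_Nil_iff)
  then show ?thesis by (simp add: exit_count_def)
qed

text \<open>
  As a function of its starting vertex, the number of exit paths to a given vertex satisfies the
  equation of a graph trace on \<open>X\<close>.
\<close>

lemma exit_count_inside:
  assumes "finite X" "acyclic_on E X" "v \<in> verts E" "v \<in> X"
  shows "exit_count E X v u = (\<Sum>e \<in> out_arcs E v. exit_count E X (head E e) u)"
proof -
  let ?S = "\<lambda>w. {p \<in> exit_paths E X w. awalk w p u}"
  have "?S v = (\<Union>e \<in> out_arcs E v. (#) e ` ?S (head E e))"
    unfolding exit_paths_inside [OF assms(4)] by (auto simp: awalk_Cons_iff)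
  also have "card \<dots> = (\<Sum>e \<in> out_arcs E v. card ((#) e ` ?S (head E e)))"
    using assms by (intro card_UN_disjoint) (auto simp: row_finite finite_exit_paths)
  also have "\<dots> = (\<Sum>e \<in> out_arcs E v. card (?S (head E e)))"
    by (intro sum.cong refl card_image) auto
  finally show ?thesis by (simp add: exit_count_def)
qed

section \<open>Left infinite vertices\<close>

lemma connects_to_iff: "connects_to E v w \<longleftrightarrow> (\<exists>p. awalk v p w)"
  by (simp add: connects_to_def)

text \<open>
  Every vertex that connects to \<open>v\<close> also connects to the ranges of the edges that \<open>v\<close> emits. This
  is what makes a function that vanishes on the left infinite vertices satisfy the trace equation there.
\<close>

lemma left_infinite_hereditary:
  assumes "left_infinite E v" "e \<in> out_arcs E v"
  shows "left_infinite E (head E e)"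
proof -
  have "connects_to E w (head E e)" if w: "connects_to E w v" for w
  proof -
    obtain p where "awalk w p v" using w by (auto simp: connects_to_iff)
    then have "awalk w (p @ [e]) (head E e)"
      using assms(2) by (auto simp: awalk_simps)
    then show ?thesis unfolding connects_to_iff by blast
  qed
  then have "{w \<in> verts E. connects_to E w v} \<subseteq> {w \<in> verts E. connects_to E w (head E e)}"
    by blast
  then show ?thesis
    using assms(1) infinite_super unfolding left_infinite_def by blast
qed

text \<open>A closed walk at \<open>v\<close> of minimal length cannot pass through \<open>v\<close> before its end.\<close>

lemma lies_on_closed_simple_path_if_closed_walk:
  assumes "awalk v p v" "p \<noteq> []"
  shows "lies_on_closed_simple_path E v"
proof -
  obtain q where q: "awalk v q v" "q \<noteq> []"
    and min: "\<And>q'. awalk v q' v \<Longrightarrow> q' \<noteq> [] \<Longrightarrow> length q \<le> length q'"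
    using ex_has_least_nat [of "\<lambda>q. awalk v q v \<and> q \<noteq> []" p length] assms by auto
  have "tail E e \<noteq> v" if e: "e \<in> set (tl q)" for e
  proof
    assume tail: "tail E e = v"
    obtain f ys zs where q': "q = (f # ys) @ e # zs"
      using e q(2) by (cases q) (auto dest: split_list)
    then have "awalk v (f # ys) v"
      using q(1) tail by (auto simp: awalk_simps)
    from min [OF this] q' show False by simp
  qed
  then have "closed_simple_path E v q" using q by (simp add: closed_simple_path_def)
  moreover have "v \<in> tail E ` set q"
    using q by (cases q) (auto simp: awalk_simps)
  ultimately show ?thesis by (auto simp: lies_on_closed_simple_path_def)
qed

lemma acyclic_on_not_left_infinite:
  assumes "\<forall>v \<in> verts E. lies_on_closed_simple_path E v \<longrightarrow> left_infinite E v"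
    and "X \<subseteq> {v \<in> verts E. \<not> left_infinite E v}"
  shows "acyclic_on E X"
  using assms lies_on_closed_simple_path_if_closed_walk unfolding acyclic_on_def by blast

end

section \<open>Injective choices\<close>

lemma distinct_representatives_of_infinite_sets:
  assumes "finite A" "\<And>a. a \<in> A \<Longrightarrow> infinite (S a)"
  shows "\<exists>f. inj_on f A \<and> (\<forall>a \<in> A. f a \<in> S a)"
  using assms
proof (induction A)
  case (insert a A)
  then obtain f where f: "inj_on f A" "\<forall>a \<in> A. f a \<in> S a" by auto
  have "infinite (S a - f ` A)" using insert by auto
  then obtain s where s: "s \<in> S a" "s \<notin> f ` A"
    by (metis Diff_iff finite.emptyI ex_in_conv)
  have "inj_on (f(a := s)) (insert a A)" "\<forall>b \<in> insert a A. (f(a := s)) b \<in> S b"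
    using f s insert.hyps by (auto simp: inj_on_def)
  then show ?case by blast
qed auto

lemma injection_if_fibers_smaller:
  assumes "finite A" "finite B"
    and "\<And>u. u \<in> f ` A \<Longrightarrow> card {a \<in> A. f a = u} \<le> card {b \<in> B. g b = u}"
  shows "\<exists>h. inj_on h A \<and> (\<forall>a \<in> A. h a \<in> B \<and> g (h a) = f a)"
proof -
  have "\<forall>u \<in> f ` A. \<exists>h. h ` {a \<in> A. f a = u} \<subseteq> {b \<in> B. g b = u} \<and> inj_on h {a \<in> A. f a = u}"
    using assms by (intro ballI card_le_inj) auto
  from bchoice [OF this] obtain h where
    h: "\<And>u. u \<in> f ` A \<Longrightarrow> h u ` {a \<in> A. f a = u} \<subseteq> {b \<in> B. g b = u}"
      "\<And>u. u \<in> f ` A \<Longrightarrow> inj_on (h u) {a \<in> A. f a = u}"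
    by blast
  have *: "h (f a) a \<in> B" "g (h (f a) a) = f a" if "a \<in> A" for a
    using h(1) [of "f a"] that by auto
  moreover have "inj_on (\<lambda>a. h (f a) a) A"
  proof (rule inj_onI)
    fix a b assume ab: "a \<in> A" "b \<in> A" "h (f a) a = h (f b) b"
    then have "f a = f b" using * by metis
    with ab h(2) [of "f a"] show "a = b" by (auto dest: inj_onD)
  qed
  ultimately show ?thesis by blast
qed

section \<open>Bounded graph traces by compactness\<close>

text \<open>
  Approximate traces on the finite subsets of \<open>U\<close> lie in a power of the unit interval, compact by
  Tychonoff's theorem, and the conditions imposed on them are closed and become stronger as \<open>Y\<close> grows; so some
  \<open>g\<close> satisfies all of them. The lower bound on \<open>V\<close> survives in the limit and keeps
  \<open>g\<close> from vanishing; the upper bounds on all \<open>Y\<close> make it bounded as a trace.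
\<close>

lemma bounded_graph_trace_from_finite_pieces:
  fixes E :: "('v, 'e) pre_digraph"
  assumes "row_finite_graph E"
    and V: "finite V" "V \<subseteq> U" and U: "U \<subseteq> verts E" and c: "c > 0"
    and her: "\<And>v e. v \<in> verts E - U \<Longrightarrow> e \<in> out_arcs E v \<Longrightarrow> head E e \<notin> U"
    and pieces: "\<And>Y. finite Y \<Longrightarrow> V \<subseteq> Y \<Longrightarrow> Y \<subseteq> U \<Longrightarrow>
      \<exists>g::'v \<Rightarrow> real. (\<forall>v. 0 \<le> g v \<and> g v \<le> 1) \<and> (\<forall>v. v \<notin> U \<longrightarrow> g v = 0) \<and>
          (\<forall>v \<in> Y. out_arcs E v \<noteq> {} \<longrightarrow> g v = (\<Sum>e \<in> out_arcs E v. g (head E e))) \<and>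
          sum g Y \<le> 1 \<and> c \<le> sum g V"
  shows "\<exists>g. bounded_graph_trace E g \<and> (\<exists>v \<in> verts E. g v \<noteq> 0)"
proof -
  interpret row_finite_graph E by fact
  let ?fams = "{Y. finite Y \<and> V \<subseteq> Y \<and> Y \<subseteq> U}"
  define C where "C Y = {g::'v \<Rightarrow> real. (\<forall>v. v \<notin> U \<longrightarrow> g v = 0) \<and>
          (\<forall>v. v \<in> Y \<longrightarrow> out_arcs E v \<noteq> {} \<longrightarrow> g v = (\<Sum>e \<in> out_arcs E v. g (head E e))) \<and>
          sum g Y \<le> 1 \<and> c \<le> sum g V}" for Y
  define Q :: "('v \<Rightarrow> real) set" where "Q = PiE UNIV (\<lambda>_. {0..1})"
  have "compactin (product_topology (\<lambda>_::'v. euclidean :: real topology) UNIV) Q"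
    unfolding Q_def compactin_PiE by simp
  then have "compact Q" by (simp add: euclidean_product_topology)
  have closed: "closed (C Y)" for Y
    unfolding C_def
    by (intro closed_Collect_conj closed_Collect_all closed_Collect_imp closed_Collect_eq
        closed_Collect_le open_Collect_const continuous_on_sum continuous_on_const
        continuous_on_product_coordinates)
  have "Q \<inter> \<Inter> (C ` ?fams) \<noteq> {}"
  proof (rule compact_imp_fip_image [OF \<open>compact Q\<close>])
    fix \<Y> assume Y: "finite \<Y>" "\<Y> \<subseteq> ?fams"
    \<comment> \<open>The conditions for one \<open>Y\<close> imply those for its subsets, so the union serves the whole finite family.\<close>
    have "\<Union>\<Y> \<union> V \<in> ?fams" using Y V by auto
    then obtain g where g: "\<forall>v. 0 \<le> g v \<and> g v \<le> 1" "\<forall>v. v \<notin> U \<longrightarrow> g v = (0::real)"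
      "\<forall>v \<in> \<Union>\<Y> \<union> V. out_arcs E v \<noteq> {} \<longrightarrow> g v = (\<Sum>e \<in> out_arcs E v. g (head E e))"
      "sum g (\<Union>\<Y> \<union> V) \<le> 1" "c \<le> sum g V"
      using pieces [of "\<Union>\<Y> \<union> V"] by auto
    have "sum g Y' \<le> 1" if "Y' \<in> \<Y>" for Y'
    proof -
      have "sum g Y' \<le> sum g (\<Union>\<Y> \<union> V)"
        using that Y V g(1) by (intro sum_mono2) auto
      with g(4) show ?thesis by simp
    qed
    then have "g \<in> Q \<inter> \<Inter> (C ` \<Y>)" using g by (auto simp: Q_def C_def)
    then show "Q \<inter> \<Inter> (C ` \<Y>) \<noteq> {}" by blast
  qed (rule closed)
  then obtain g where g: "g \<in> Q" "\<And>Y. Y \<in> ?fams \<Longrightarrow> g \<in> C Y" by blast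
  have nonneg: "0 \<le> g v" for v using g(1) by (auto simp: Q_def PiE_iff)
  have Vfam: "V \<in> ?fams" using V by simp
  from g(2) [OF Vfam] have out: "v \<notin> U \<Longrightarrow> g v = 0" and pos: "c \<le> sum g V" for v
    by (auto simp: C_def)
  have "graph_trace E g"
    unfolding graph_trace_def
  proof (intro conjI ballI impI nonneg)
    fix v assume v: "v \<in> verts E" "out_arcs E v \<noteq> {}"
    show "g v = (\<Sum>e \<in> out_arcs E v. g (head E e))"
    proof (cases "v \<in> U")
      case True
      then have "insert v V \<in> ?fams" using V by auto
      from g(2) [OF this] v(2) show ?thesis by (auto simp: C_def)
    next
      case False
      then have "g (head E e) = 0" if "e \<in> out_arcs E v" for e
        using her [of v e] that v(1) out by auto
      with False out show ?thesis by simp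
    qed
  qed
  moreover have "g summable_on verts E"
  proof (rule nonneg_bounded_partial_sums_imp_summable_on)
    show "\<forall>\<^sub>F F in finite_subsets_at_top (verts E). sum g F \<le> 1"
    proof (rule eventually_finite_subsets_at_top_weakI)
      fix F assume F: "finite F" "F \<subseteq> verts E"
      have fam: "F \<inter> U \<union> V \<in> ?fams" using F V by auto
      have "sum g F = sum g (F \<inter> U)"
        using F out by (intro sum.mono_neutral_right) auto
      also have "\<dots> \<le> sum g (F \<inter> U \<union> V)"
        using F V nonneg by (intro sum_mono2) auto
      also have "\<dots> \<le> 1" using g(2) [OF fam] by (auto simp: C_def)
      finally show "sum g F \<le> 1" .
    qed
  qed (rule nonneg)
  moreover have "\<exists>v \<in> verts E. g v \<noteq> 0"
  proof (rule ccontr)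
    assume "\<not> ?thesis"
    then have "sum g V = 0" using V U by (intro sum.neutral) auto
    with pos c show False by simp
  qed
  ultimately show ?thesis unfolding bounded_graph_trace_def by blast
qed

section \<open>Rerouting paths away from a set of vertices\<close>

context row_finite_graph
begin

lemma exit_path_awlast:
  assumes "p \<in> exit_paths E X v"
  shows "awalk v p (awlast v p)"
  using assms by (auto simp: exit_paths_def)

lemma card_exit_paths_to:
  assumes "finite X" "acyclic_on E X" "finite V" "V \<subseteq> verts E"
  shows "card {a \<in> Sigma V (exit_paths E X). awlast (fst a) (snd a) = u} =
    (\<Sum>v \<in> V. exit_count E X v u)"
proof -
  have "{a \<in> Sigma V (exit_paths E X). awlast (fst a) (snd a) = u}
      = Sigma V (\<lambda>v. {p \<in> exit_paths E X v. awalk v p u})"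
    by (auto dest: exit_path_awlast)
  also have "card \<dots> = (\<Sum>v \<in> V. card {p \<in> exit_paths E X v. awalk v p u})"
    using assms by (intro card_SigmaI) (auto intro: finite_subset [OF _ finite_exit_paths])
  finally show ?thesis by (simp add: exit_count_def)
qed

text \<open>
  If no finite \<open>Y\<close> works, then each one that contains \<open>V \<inter> U\<close> has a vertex \<open>u\<close> reached by more exit
  paths from \<open>V\<close> than from the rest of \<open>Y\<close>. Let \<open>N\<close> be the number of all exit paths from \<open>Y\<close> to
  \<open>u\<close>. The function sending \<open>v\<close> to the number of exit paths from \<open>v\<close> to \<open>u\<close>, divided by \<open>N\<close>, satisfies the
  trace equation on \<open>Y\<close>, has sum \<open>1\<close> over \<open>Y\<close>, and has more than half of this sum on \<open>V\<close>; by
  compactness these functions yield a nonzero bounded graph trace.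
\<close>

lemma exit_paths_dominated:
  assumes cyclic: "\<forall>v \<in> verts E. lies_on_closed_simple_path E v \<longrightarrow> left_infinite E v"
    and no_trace: "\<not> (\<exists>g. bounded_graph_trace E g \<and> (\<exists>v \<in> verts E. g v \<noteq> 0))"
    and V: "finite V" "V \<subseteq> verts E"
  defines "U \<equiv> {v \<in> verts E. \<not> left_infinite E v}"
  shows "\<exists>Y. finite Y \<and> Y \<subseteq> U \<and>
    (\<forall>u \<in> U. (\<Sum>v \<in> V. exit_count E {y \<in> Y. out_arcs E y \<noteq> {}} v u)
      \<le> (\<Sum>w \<in> Y - V. exit_count E {y \<in> Y. out_arcs E y \<noteq> {}} w u))"
proof (rule ccontr)
  assume contra: "\<not> ?thesis"
  have "\<exists>g. bounded_graph_trace E g \<and> (\<exists>v \<in> verts E. g v \<noteq> 0)"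
  proof (rule bounded_graph_trace_from_finite_pieces [where V = "V \<inter> U" and U = U and c = "1/2"])
    show "head E e \<notin> U" if "v \<in> verts E - U" "e \<in> out_arcs E v" for v e
      using left_infinite_hereditary [of v e] that by (auto simp: U_def)
  next
    fix Y assume Y: "finite Y" "V \<inter> U \<subseteq> Y" "Y \<subseteq> U"
    define X where "X = {y \<in> Y. out_arcs E y \<noteq> {}}"
    let ?c = "exit_count E X"
    obtain u where u: "u \<in> U" "(\<Sum>w \<in> Y - V. ?c w u) < (\<Sum>v \<in> V. ?c v u)"
      using contra Y unfolding X_def not_ex de_Morgan_conj not_le [symmetric] by blast
    have "finite X" "acyclic_on E X"
      using Y by (auto simp: X_def U_def intro!: acyclic_on_not_left_infinite [OF cyclic])
    note X = this
    \<comment> \<open>A left infinite vertex lies outside \<open>X\<close>, so its only exit path is trivial and misses \<open>u\<close>.\<close>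
    have out: "?c v u = 0" if "v \<in> verts E" "v \<notin> U" for v
      using that u(1) Y(3) by (subst exit_count_outside) (auto simp: X_def)
    have "\<forall>v \<in> V - V \<inter> U. ?c v u = 0" using V(2) out by blast
    then have "(\<Sum>v \<in> V. ?c v u) = (\<Sum>v \<in> V \<inter> U. ?c v u)"
      using V(1) by (intro sum.mono_neutral_right) auto
    moreover have "(\<Sum>v \<in> Y. ?c v u) = (\<Sum>v \<in> V \<inter> U. ?c v u) + (\<Sum>w \<in> Y - V. ?c w u)"
      using Y V by (subst sum.union_disjoint [symmetric]) (auto intro: sum.cong)
    moreover define N where "N = (\<Sum>v \<in> Y. ?c v u)"
    ultimately have N: "N < 2 * (\<Sum>v \<in> V \<inter> U. ?c v u)" "0 < N" using u(2) by linarith+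
    define g where "g v = (if v \<in> U then ?c v u / N else 0)" for v
    have eq: "g v = ?c v u / N" if "v \<in> verts E" for v
      using out that by (auto simp: g_def)
    have "g v \<le> 1" for v
    proof (cases "v \<in> U")
      case True
      have "?c v u \<le> N"
      proof (cases "v \<in> Y")
        case True
        then show ?thesis unfolding N_def using Y by (intro member_le_sum) auto
      next
        case False
        then have "?c v u \<le> 1"
          using True by (subst exit_count_outside) (auto simp: X_def U_def)
        with N show ?thesis by linarith
      qed
      with N True show ?thesis by (simp add: g_def)
    qed (simp add: g_def)
    moreover have "g v = (\<Sum>e \<in> out_arcs E v. g (head E e))"
      if "v \<in> Y" "out_arcs E v \<noteq> {}" for v
    proof -
      have v: "v \<in> verts E" "v \<in> X" using that Y by (auto simp: X_def U_def)
      have "g v = (\<Sum>e \<in> out_arcs E v. ?c (head E e) u) / N"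
        unfolding eq [OF v(1)] by (subst exit_count_inside) (use X v in auto)
      also have "\<dots> = (\<Sum>e \<in> out_arcs E v. ?c (head E e) u / N)"
        by (simp add: sum_divide_distrib)
      also have "\<dots> = (\<Sum>e \<in> out_arcs E v. g (head E e))"
        by (intro sum.cong refl eq [symmetric]) auto
      finally show ?thesis .
    qed
    moreover have sums: "sum g Z = (\<Sum>v \<in> Z. ?c v u) / N" if "Z \<subseteq> verts E" for Z
      using that by (simp add: sum_divide_distrib eq subset_iff)
    have "sum g Y \<le> 1"
      using Y N by (subst sums) (auto simp: U_def N_def)
    moreover have "1/2 \<le> sum g (V \<inter> U)"
      using V N by (subst sums) (auto simp: field_simps simp flip: of_nat_sum)
    ultimately show "\<exists>g. (\<forall>v. 0 \<le> g v \<and> g v \<le> (1::real)) \<and> (\<forall>v. v \<notin> U \<longrightarrow> g v = 0) \<and>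
          (\<forall>v \<in> Y. out_arcs E v \<noteq> {} \<longrightarrow> g v = (\<Sum>e \<in> out_arcs E v. g (head E e))) \<and>
          sum g Y \<le> 1 \<and> 1/2 \<le> sum g (V \<inter> U)"
      by (intro exI [of _ g]) (auto simp: g_def)
  qed (use V row_finite_graph_axioms in \<open>auto simp: U_def\<close>)
  with no_trace show False by blast
qed

text \<open>
  The exit paths from \<open>V\<close> are replaced injectively by paths with the same ranges that start outside
  \<open>V\<close>, none of which extends another. Ranges that are left infinite cost nothing, because
  infinitely many starting vertices are available for each of them; for the other ranges the counting
  inequality supplies the replacements.
\<close>

lemma exit_paths_rerouted:
  assumes cyclic: "\<forall>v \<in> verts E. lies_on_closed_simple_path E v \<longrightarrow> left_infinite E v"
    and no_trace: "\<not> (\<exists>g. bounded_graph_trace E g \<and> (\<exists>v \<in> verts E. g v \<noteq> 0))"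
    and V: "finite V" "V \<subseteq> verts E"
  shows "\<exists>X f. finite X \<and> acyclic_on E X \<and> (\<forall>v \<in> X. out_arcs E v \<noteq> {}) \<and>
    (\<forall>a \<in> Sigma V (exit_paths E X). fst (f a) \<in> verts E - V \<and>
      (\<exists>u. awalk (fst a) (snd a) u \<and> awalk (fst (f a)) (snd (f a)) u)) \<and>
    (\<forall>a \<in> Sigma V (exit_paths E X). \<forall>b \<in> Sigma V (exit_paths E X).
      a \<noteq> b \<longrightarrow> fst (f a) = fst (f b) \<longrightarrow> (\<forall>r. snd (f a) @ r \<noteq> snd (f b)))"
proof -
  define U where "U = {v \<in> verts E. \<not> left_infinite E v}"
  obtain Y where Y: "finite Y" "Y \<subseteq> U" and le:
    "\<And>u. u \<in> U \<Longrightarrow> (\<Sum>v \<in> V. exit_count E {y \<in> Y. out_arcs E y \<noteq> {}} v u)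
      \<le> (\<Sum>w \<in> Y - V. exit_count E {y \<in> Y. out_arcs E y \<noteq> {}} w u)"
    using exit_paths_dominated [OF cyclic no_trace V] unfolding U_def by blast
  define X where "X = {y \<in> Y. out_arcs E y \<noteq> {}}"
  have X: "finite X" "acyclic_on E X"
    using Y by (auto simp: X_def U_def intro!: acyclic_on_not_left_infinite [OF cyclic])
  let ?end = "\<lambda>a. awlast (fst a) (snd a)"
  define A where "A = Sigma V (exit_paths E X)"
  define B where "B = Sigma (Y - V) (exit_paths E X)"
  have YV: "finite (Y - V)" "Y - V \<subseteq> verts E" using Y by (auto simp: U_def)
  have fin: "finite A" "finite B"
    unfolding A_def B_def using V YV X by (auto intro!: finite_SigmaI finite_exit_paths)
  have endA: "awalk (fst a) (snd a) (?end a)" if "a \<in> A" for a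
    using that by (auto simp: A_def intro: exit_path_awlast)
  \<comment> \<open>Paths ending in \<open>U\<close> are matched with exit paths from \<open>Y - V\<close>, as there are enough of these.\<close>
  have "\<exists>h. inj_on h {a \<in> A. ?end a \<in> U} \<and>
      (\<forall>a \<in> {a \<in> A. ?end a \<in> U}. h a \<in> B \<and> ?end (h a) = ?end a)"
  proof (rule injection_if_fibers_smaller)
    fix u assume "u \<in> ?end ` {a \<in> A. ?end a \<in> U}"
    then have u: "u \<in> U" by auto
    have "card {a \<in> {a \<in> A. ?end a \<in> U}. ?end a = u} \<le> card {a \<in> A. ?end a = u}"
      using fin by (intro card_mono) auto
    also have "\<dots> \<le> card {b \<in> B. ?end b = u}"
      unfolding A_def B_def card_exit_paths_to [OF X V] card_exit_paths_to [OF X YV]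
      using le [OF u] by (simp add: X_def)
    finally show "card {a \<in> {a \<in> A. ?end a \<in> U}. ?end a = u} \<le> card {b \<in> B. ?end b = u}" .
  qed (use fin in auto)
  then obtain h where h: "inj_on h {a \<in> A. ?end a \<in> U}"
    and "\<forall>a \<in> {a \<in> A. ?end a \<in> U}. h a \<in> B \<and> ?end (h a) = ?end a"
    by (elim exE conjE)
  then have hB: "h a \<in> B \<and> ?end (h a) = ?end a" if "a \<in> A" "?end a \<in> U" for a
    using that by blast
  \<comment> \<open>A path ending at a left infinite vertex is matched with a path from a starting vertex used by no other.\<close>
  have "\<exists>k. inj_on k {a \<in> A. ?end a \<notin> U} \<and>
      (\<forall>a \<in> {a \<in> A. ?end a \<notin> U}. k a \<in> {w \<in> verts E. connects_to E w (?end a)} - (V \<union> Y))"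
  proof (rule distinct_representatives_of_infinite_sets)
    fix a assume "a \<in> {a \<in> A. ?end a \<notin> U}"
    then have "left_infinite E (?end a)"
      using awalk_last_in_verts [OF endA [of a]] by (auto simp: U_def)
    then show "infinite ({w \<in> verts E. connects_to E w (?end a)} - (V \<union> Y))"
      using V Y unfolding left_infinite_def by (intro Diff_infinite_finite) auto
  qed (use fin in auto)
  then obtain k where k: "inj_on k {a \<in> A. ?end a \<notin> U}"
    and "\<forall>a \<in> {a \<in> A. ?end a \<notin> U}.
      k a \<in> {w \<in> verts E. connects_to E w (?end a)} - (V \<union> Y)" by (elim exE conjE)
  then have kW: "k a \<in> verts E \<and> k a \<notin> V \<union> Y \<and> (\<exists>q. awalk (k a) q (?end a))"
    if "a \<in> A" "?end a \<notin> U" for a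
    using that unfolding connects_to_iff by blast
  have "\<forall>a \<in> {a \<in> A. ?end a \<notin> U}. \<exists>q. awalk (k a) q (?end a)" using kW by blast
  from bchoice [OF this] obtain q where
    q: "\<And>a. a \<in> A \<Longrightarrow> ?end a \<notin> U \<Longrightarrow> awalk (k a) (q a) (?end a)" by blast
  define f where "f a = (if ?end a \<in> U then h a else (k a, q a))" for a
  have f1: "fst (f a) \<in> verts E - V \<and>
      (\<exists>u. awalk (fst a) (snd a) u \<and> awalk (fst (f a)) (snd (f a)) u)" if a: "a \<in> A" for a
  proof (cases "?end a \<in> U")
    case True
    then have "h a \<in> B" "?end (h a) = ?end a" using hB a by auto
    then have "fst (h a) \<in> verts E - V" "awalk (fst (h a)) (snd (h a)) (?end a)"
      using YV exit_path_awlast [of "snd (h a)" X "fst (h a)"] by (auto simp: B_def)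
    with endA [OF a] True show ?thesis by (auto simp: f_def)
  next
    case False
    with kW [OF a False] q [OF a False] endA [OF a] show ?thesis by (auto simp: f_def)
  qed
  have f2: "snd (f a) @ r \<noteq> snd (f b)"
    if ab: "a \<in> A" "b \<in> A" "a \<noteq> b" "fst (f a) = fst (f b)" for a b r
  proof
    assume r: "snd (f a) @ r = snd (f b)"
    \<comment> \<open>The starting vertex tells which of the two kinds of replacement was made.\<close>
    have inY: "fst (f c) \<in> Y \<longleftrightarrow> ?end c \<in> U" if "c \<in> A" for c
      using hB [OF that] kW [OF that] by (auto simp: f_def B_def)
    show False
    proof (cases "?end a \<in> U")
      case True
      then have "?end b \<in> U" using ab inY by metis
      note U = True this
      have B: "h a \<in> B" "h b \<in> B" using U hB ab by auto
      have fst_eq: "fst (h a) = fst (h b)" and app: "snd (h a) @ r = snd (h b)"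
        using ab r U by (auto simp: f_def)
      have "snd (h a) \<in> exit_paths E X (fst (h a))" "snd (h b) \<in> exit_paths E X (fst (h b))"
        using B by (auto simp: B_def)
      then have "r = []" unfolding app [symmetric] fst_eq [symmetric]
        by (rule exit_paths_prefix_free)
      with app fst_eq have "h a = h b" by (simp add: prod_eq_iff)
      with h ab U show False by (auto dest: inj_onD)
    next
      case False
      then have "?end b \<notin> U" using ab inY by metis
      with False k ab show False by (auto simp: f_def dest: inj_onD)
    qed
  qed
  show ?thesis
    by (rule exI [of _ X], rule exI [of _ f], fold A_def) (use X f1 f2 in \<open>auto simp: X_def\<close>)
qed

end

section \<open>Stable rank and orthogonal copies\<close>

context ring
begin

lemma finsum_only_term:
  assumes "finite A" "a \<in> A" "f \<in> A \<rightarrow> carrier R" "\<And>b. b \<in> A \<Longrightarrow> b \<noteq> a \<Longrightarrow> f b = \<zero>"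
  shows "(\<Oplus>b \<in> A. f b) = f a"
proof -
  have "(\<Oplus>b \<in> A. f b) = (\<Oplus>b \<in> A. if a = b then f b else \<zero>)"
    using assms by (intro finsum_cong') auto
  also have "\<dots> = f a" using assms by (intro finsum_singleton)
  finally show ?thesis .
qed

lemma finsum_all_zero:
  assumes "\<And>a. a \<in> A \<Longrightarrow> f a = \<zero>"
  shows "(\<Oplus>a \<in> A. f a) = \<zero>"
proof -
  have "(\<Oplus>a \<in> A. f a) = (\<Oplus>a \<in> A. \<zero>)" using assms by (intro finsum_cong') auto
  then show ?thesis by simp
qed

text \<open>
  The hypotheses on \<open>\<gamma>\<close> and \<open>\<delta>\<close> make the double sum for \<open>x y\<close> collapse to its diagonal, where the inner
  factors \<open>\<delta> a \<gamma> a\<close> are absorbed by \<open>\<alpha> a\<close>. An idempotent \<open>p\<close> is thereby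
  equivalent to the idempotent \<open>y p x\<close>, which is orthogonal to \<open>p\<close>.
\<close>

lemma orthogonal_copy:
  assumes A: "finite A"
    and c [simp]: "\<And>a. a \<in> A \<Longrightarrow> \<alpha> a \<in> carrier R" "\<And>a. a \<in> A \<Longrightarrow> \<beta> a \<in> carrier R"
      "\<And>a. a \<in> A \<Longrightarrow> \<gamma> a \<in> carrier R" "\<And>a. a \<in> A \<Longrightarrow> \<delta> a \<in> carrier R" "p \<in> carrier R"
    and p: "(\<Oplus>a \<in> A. \<alpha> a \<otimes> \<beta> a) = p"
    and diag: "\<And>a. a \<in> A \<Longrightarrow> \<alpha> a \<otimes> (\<delta> a \<otimes> \<gamma> a) = \<alpha> a"
    and off: "\<And>a b. a \<in> A \<Longrightarrow> b \<in> A \<Longrightarrow> a \<noteq> b \<Longrightarrow> \<delta> a \<otimes> \<gamma> b = \<zero>"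
    and orth: "\<And>a. a \<in> A \<Longrightarrow> \<delta> a \<otimes> p = \<zero>" "\<And>a. a \<in> A \<Longrightarrow> p \<otimes> \<gamma> a = \<zero>"
  defines "x \<equiv> \<Oplus>a \<in> A. \<alpha> a \<otimes> \<delta> a" and "y \<equiv> \<Oplus>a \<in> A. \<gamma> a \<otimes> \<beta> a"
  shows "x \<otimes> y = p" "x \<otimes> p = \<zero>" "p \<otimes> y = \<zero>"
proof -
  have y: "y \<in> carrier R" unfolding y_def by (rule finsum_closed) auto
  have "(\<alpha> a \<otimes> \<delta> a) \<otimes> y = \<alpha> a \<otimes> \<beta> a" if a: "a \<in> A" for a
  proof -
    have "\<delta> a \<otimes> y = (\<Oplus>b \<in> A. \<delta> a \<otimes> (\<gamma> b \<otimes> \<beta> b))"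
      unfolding y_def using a A by (intro finsum_rdistr) auto
    also have "\<dots> = \<delta> a \<otimes> (\<gamma> a \<otimes> \<beta> a)"
    proof (rule finsum_only_term)
      fix b assume b: "b \<in> A" "b \<noteq> a"
      then have "\<delta> a \<otimes> (\<gamma> b \<otimes> \<beta> b) = (\<delta> a \<otimes> \<gamma> b) \<otimes> \<beta> b"
        using a by (simp add: m_assoc)
      with off [of a b] a b show "\<delta> a \<otimes> (\<gamma> b \<otimes> \<beta> b) = \<zero>" by simp
    qed (use a A in auto)
    finally have "(\<alpha> a \<otimes> \<delta> a) \<otimes> y = (\<alpha> a \<otimes> (\<delta> a \<otimes> \<gamma> a)) \<otimes> \<beta> a"
      using a y by (simp add: m_assoc)
    with diag [OF a] show ?thesis by simp
  qed
  then have "(\<Oplus>a \<in> A. (\<alpha> a \<otimes> \<delta> a) \<otimes> y) = (\<Oplus>a \<in> A. \<alpha> a \<otimes> \<beta> a)"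
    by (intro finsum_cong') auto
  then show "x \<otimes> y = p"
    unfolding x_def using y A p by (subst finsum_ldistr) auto
  have "x \<otimes> p = (\<Oplus>a \<in> A. (\<alpha> a \<otimes> \<delta> a) \<otimes> p)"
    unfolding x_def using A by (intro finsum_ldistr) auto
  also have "\<dots> = \<zero>" by (rule finsum_all_zero) (simp add: m_assoc orth)
  finally show "x \<otimes> p = \<zero>" .
  have "p \<otimes> y = (\<Oplus>a \<in> A. p \<otimes> (\<gamma> a \<otimes> \<beta> a))"
    unfolding y_def using A by (intro finsum_rdistr) auto
  also have "\<dots> = \<zero>" by (rule finsum_all_zero) (simp add: m_assoc [symmetric] orth)
  finally show "p \<otimes> y = \<zero>" .
qed

lemma ideal_finsum_closed:
  assumes "ideal I R" "\<And>a. a \<in> A \<Longrightarrow> f a \<in> I"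
  shows "(\<Oplus>a \<in> A. f a) \<in> I"
proof -
  interpret I: ideal I R by fact
  show ?thesis
    using assms(2)
  proof (induction A rule: infinite_finite_induct)
    case (insert a A)
    then have "f a \<in> carrier R" "f \<in> A \<rightarrow> carrier R" by (auto intro: I.Icarr)
    with insert show ?case by simp
  qed simp_all
qed

text \<open>
  Let \<open>p\<close> be a left unit for the last two entries \<open>b\<^sub>2\<close>, \<open>b\<^sub>3\<close> of a vector. Adding \<open>y b\<^sub>3\<close> to \<open>b\<^sub>2\<close> stores
  \<open>b\<^sub>3\<close> in a place orthogonal to \<open>b\<^sub>2\<close>, and nothing is lost: \<open>p (b\<^sub>2 + y b\<^sub>3) = b\<^sub>2\<close> and
  \<open>x (b\<^sub>2 + y b\<^sub>3) = b\<^sub>3\<close>. The coefficients \<open>a\<^sub>1\<close> and \<open>a\<^sub>2 p + a\<^sub>3 x\<close> therefore show that the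
  shortened vector is unimodular.
\<close>

lemma in_stable_range_2_if_orthogonal_copies:
  assumes "ideal I R"
    and copies: "\<And>b c. b \<in> I \<Longrightarrow> c \<in> I \<Longrightarrow> \<exists>p \<in> I. \<exists>x \<in> I. \<exists>y \<in> I.
      p \<otimes> b = b \<and> p \<otimes> c = c \<and> x \<otimes> y = p \<and> x \<otimes> p = \<zero> \<and> p \<otimes> y = \<zero>"
  shows "in_stable_range R I 2"
  unfolding in_stable_range_def
proof (intro allI impI)
  interpret I: ideal I R by fact
  have set3: "{1..2 + 1} = {1, 2, 3::nat}" "{2..2 + 1} = {2, 3::nat}" "{1..2} = {1, 2::nat}"
    "{2..2} = {2::nat}" by auto
  fix b assume b: "rel_unimodular R I (2 + 1) b"
  then obtain a where a: "rel_unital_vector R I (2 + 1) a"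
    and ab: "(\<Oplus>i \<in> {1..2 + 1}. a i \<otimes> b i) = \<one>"
    by (auto simp: rel_unimodular_def)
  have c [simp]: "a 1 \<in> carrier R" "a 2 \<in> carrier R" "a 3 \<in> carrier R"
    "b 1 \<in> carrier R" "b 2 \<in> carrier R" "b 3 \<in> carrier R"
    and aI: "a 1 \<ominus> \<one> \<in> I" "a 2 \<in> I" "a 3 \<in> I"
    and bI: "b 1 \<ominus> \<one> \<in> I" "b 2 \<in> I" "b 3 \<in> I"
    using a b unfolding rel_unimodular_def rel_unital_vector_def set3 by auto
  have c1 [simp]: "a (Suc 0) \<in> carrier R" "b (Suc 0) \<in> carrier R"
    using c by simp_all
  from ab have one: "a 1 \<otimes> b 1 \<oplus> (a 2 \<otimes> b 2 \<oplus> a 3 \<otimes> b 3) = \<one>"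
    unfolding set3 by simp
  obtain p x y where I: "p \<in> I" "x \<in> I" "y \<in> I"
    and p: "p \<otimes> b 2 = b 2" "p \<otimes> b 3 = b 3"
    and xy: "x \<otimes> y = p" "x \<otimes> p = \<zero>" "p \<otimes> y = \<zero>"
    using copies [OF bI(2,3)] by blast
  have d [simp]: "p \<in> carrier R" "x \<in> carrier R" "y \<in> carrier R"
    using I I.Icarr by auto
  let ?v = "\<lambda>i::nat. if i = 2 then y else \<zero>"
  let ?b = "\<lambda>i. b i \<oplus> ?v i \<otimes> b (2 + 1)"
  let ?a = "\<lambda>i::nat. if i = 2 then a 2 \<otimes> p \<oplus> a 3 \<otimes> x else a i"
  have "x \<otimes> b 2 = \<zero>" using xy(2) p(1) by (metis d(1,2) c(5) m_assoc l_null)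
  then have x: "x \<otimes> (b 2 \<oplus> y \<otimes> b 3) = b 3"
    using xy(1) p(2) by (simp add: r_distr m_assoc [symmetric])
  have py: "p \<otimes> (b 2 \<oplus> y \<otimes> b 3) = b 2"
    using xy(3) p(1) by (simp add: r_distr m_assoc [symmetric])
  have "(a 2 \<otimes> p \<oplus> a 3 \<otimes> x) \<otimes> (b 2 \<oplus> y \<otimes> b 3) = a 2 \<otimes> b 2 \<oplus> a 3 \<otimes> b 3"
    using x py by (simp add: l_distr m_assoc)
  then have "(\<Oplus>i \<in> {1..2}. ?a i \<otimes> ?b i) = \<one>"
    unfolding set3 using one by simp
  moreover have "rel_unital_vector R I 2 ?a" "rel_unital_vector R I 2 ?b"
    unfolding rel_unital_vector_def set3
    using aI bI I by (auto intro!: I.a_closed I.I_l_closed I.I_r_closed)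
  ultimately have "rel_unimodular R I 2 ?b" by (auto simp: rel_unimodular_def)
  moreover have "\<forall>i \<in> {1..2}. ?v i \<in> I" using I by simp
  ultimately show "\<exists>v. (\<forall>i \<in> {1..2}. v i \<in> I) \<and>
      rel_unimodular R I 2 (\<lambda>i. b i \<oplus> v i \<otimes> b (2 + 1))"
    by (intro exI [of _ ?v] conjI)
qed

end

section \<open>Path elements in a Leavitt family\<close>

text \<open>
  A family of elements of a unital ring subject to the relations of the Leavitt path algebra. The ring
  may be larger than the subring generated by the family; this allows the unitization.
\<close>

locale leavitt_family = ring R + row_finite_graph E
  for R (structure) and E :: "('v, 'e) pre_digraph" +
  fixes vx :: "'v \<Rightarrow> 'a" and ed gh :: "'e \<Rightarrow> 'a"
  assumes vx_closed [simp]: "v \<in> verts E \<Longrightarrow> vx v \<in> carrier R"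
    and ed_closed [simp]: "e \<in> arcs E \<Longrightarrow> ed e \<in> carrier R"
    and gh_closed [simp]: "e \<in> arcs E \<Longrightarrow> gh e \<in> carrier R"
    and vx_idem: "v \<in> verts E \<Longrightarrow> vx v \<otimes> vx v = vx v"
    and vx_orth: "v \<in> verts E \<Longrightarrow> w \<in> verts E \<Longrightarrow> v \<noteq> w \<Longrightarrow> vx v \<otimes> vx w = \<zero>"
    and tail_ed: "e \<in> arcs E \<Longrightarrow> vx (tail E e) \<otimes> ed e = ed e"
    and ed_head: "e \<in> arcs E \<Longrightarrow> ed e \<otimes> vx (head E e) = ed e"
    and head_gh: "e \<in> arcs E \<Longrightarrow> vx (head E e) \<otimes> gh e = gh e"
    and gh_tail: "e \<in> arcs E \<Longrightarrow> gh e \<otimes> vx (tail E e) = gh e"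
    and gh_ed: "e \<in> arcs E \<Longrightarrow> gh e \<otimes> ed e = vx (head E e)"
    and gh_ed_orth: "e \<in> arcs E \<Longrightarrow> f \<in> arcs E \<Longrightarrow> e \<noteq> f \<Longrightarrow> gh e \<otimes> ed f = \<zero>"
    and ed_gh_sum: "v \<in> verts E \<Longrightarrow> out_arcs E v \<noteq> {} \<Longrightarrow>
      vx v = (\<Oplus>e \<in> out_arcs E v. ed e \<otimes> gh e)"
begin

primrec path_elt :: "'v \<Rightarrow> 'e list \<Rightarrow> 'a" where
  "path_elt v [] = vx v"
| "path_elt v (e # p) = ed e \<otimes> path_elt (head E e) p"

primrec ghost_elt :: "'v \<Rightarrow> 'e list \<Rightarrow> 'a" where
  "ghost_elt v [] = vx v"
| "ghost_elt v (e # p) = ghost_elt (head E e) p \<otimes> gh e"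

lemma path_elt_closed [simp]: "awalk v p w \<Longrightarrow> path_elt v p \<in> carrier R"
  by (induction p arbitrary: v) (auto simp: awalk_simps)

lemma ghost_elt_closed [simp]: "awalk v p w \<Longrightarrow> ghost_elt v p \<in> carrier R"
  by (induction p arbitrary: v) (auto simp: awalk_simps)

lemma path_elt_start: "awalk v p w \<Longrightarrow> vx v \<otimes> path_elt v p = path_elt v p"
  by (cases p) (auto simp: awalk_simps vx_idem tail_ed m_assoc [symmetric])

lemma path_elt_end: "awalk v p w \<Longrightarrow> path_elt v p \<otimes> vx w = path_elt v p"
proof (induction p arbitrary: v)
  case (Cons e p)
  then have "awalk (head E e) p w" "e \<in> arcs E" "w \<in> verts E"
    by (auto simp: awalk_Cons_iff dest: awalk_last_in_verts)
  with Cons.IH show ?case by (simp add: m_assoc)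
qed (auto simp: awalk_simps vx_idem)

lemma ghost_elt_start: "awalk v p w \<Longrightarrow> ghost_elt v p \<otimes> vx v = ghost_elt v p"
  by (cases p) (auto simp: awalk_simps vx_idem gh_tail m_assoc)

lemma ghost_path_same: "awalk v p w \<Longrightarrow> ghost_elt v p \<otimes> path_elt v p = vx w"
proof (induction p arbitrary: v)
  case (Cons e p)
  then have w: "awalk (head E e) p w" and [simp]: "e \<in> arcs E"
    by (auto simp: awalk_Cons_iff)
  note [simp] = path_elt_closed [OF w] ghost_elt_closed [OF w]
  have "ghost_elt v (e # p) \<otimes> path_elt v (e # p)
      = ghost_elt (head E e) p \<otimes> ((gh e \<otimes> ed e) \<otimes> path_elt (head E e) p)"
    by (simp add: m_assoc)
  then show ?case using Cons.IH [OF w] path_elt_start [OF w] by (simp add: gh_ed)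
qed (auto simp: awalk_simps vx_idem)

lemma ghost_vx_orth:
  assumes "awalk v p w" "v' \<in> verts E" "v \<noteq> v'"
  shows "ghost_elt v p \<otimes> vx v' = \<zero>"
proof -
  have v: "v \<in> verts E" using assms(1) by (rule awalk_hd_in_verts)
  have "ghost_elt v p \<otimes> vx v' = (ghost_elt v p \<otimes> vx v) \<otimes> vx v'"
    using ghost_elt_start [OF assms(1)] by simp
  also have "\<dots> = \<zero>"
    using assms v by (simp add: m_assoc vx_orth ghost_elt_closed [OF assms(1)])
  finally show ?thesis .
qed

lemma vx_path_orth:
  assumes "awalk v p w" "v' \<in> verts E" "v \<noteq> v'"
  shows "vx v' \<otimes> path_elt v p = \<zero>"
proof -
  have v: "v \<in> verts E" using assms(1) by (rule awalk_hd_in_verts)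
  have "vx v' \<otimes> path_elt v p = (vx v' \<otimes> vx v) \<otimes> path_elt v p"
    using path_elt_start [OF assms(1)] assms v
    by (simp add: m_assoc path_elt_closed [OF assms(1)])
  then show ?thesis
    using assms v by (simp add: vx_orth path_elt_closed [OF assms(1)])
qed

lemma ghost_path_start_orth:
  assumes p: "awalk v p w" and q: "awalk v' q w'" and "v \<noteq> v'"
  shows "ghost_elt v p \<otimes> path_elt v' q = \<zero>"
proof -
  have v': "v' \<in> verts E" using q by (rule awalk_hd_in_verts)
  have "ghost_elt v p \<otimes> path_elt v' q = (ghost_elt v p \<otimes> vx v') \<otimes> path_elt v' q"
    using path_elt_start [OF q] v'
    by (simp add: m_assoc path_elt_closed [OF q] ghost_elt_closed [OF p])
  also have "\<dots> = \<zero>"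
    using ghost_vx_orth [OF p v' assms(3)] by (simp add: path_elt_closed [OF q])
  finally show ?thesis .
qed

text \<open>
  Two such paths first differ at some edge, and there \<open>e\<^sup>* f = 0\<close>.
\<close>

lemma ghost_path_incomparable:
  assumes "awalk v p w" "awalk v q w'" "\<And>r. p @ r \<noteq> q" "\<And>r. q @ r \<noteq> p"
  shows "ghost_elt v p \<otimes> path_elt v q = \<zero>"
  using assms
proof (induction p arbitrary: v q)
  case (Cons e p)
  then obtain f q' where q: "q = f # q'" by (cases q) auto
  with Cons.prems have w: "awalk (head E e) p w" "awalk (head E f) q' w'"
    and a [simp]: "e \<in> arcs E" "f \<in> arcs E"
    by (auto simp: awalk_Cons_iff)
  note [simp] = path_elt_closed [OF w(2)] ghost_elt_closed [OF w(1)]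
  have eq: "ghost_elt v (e # p) \<otimes> path_elt v q
      = ghost_elt (head E e) p \<otimes> ((gh e \<otimes> ed f) \<otimes> path_elt (head E f) q')"
    by (simp add: q m_assoc)
  show ?case
  proof (cases "e = f")
    case True
    then have "ghost_elt (head E e) p \<otimes> path_elt (head E e) q' = \<zero>"
      using w Cons.prems(3,4) q by (intro Cons.IH) auto
    with eq True path_elt_start [OF w(2)] show ?thesis by (simp add: gh_ed)
  next
    case False
    then show ?thesis unfolding eq by (simp add: gh_ed_orth)
  qed
qed auto

text \<open>
  Repeated use of \<open>u = \<Sum> e e\<^sup>*\<close> at the vertices \<open>u\<close> of \<open>X\<close>, which all emit edges.
\<close>

lemma exit_paths_sum:
  assumes "finite X" "acyclic_on E X" "\<And>v. v \<in> X \<Longrightarrow> out_arcs E v \<noteq> {}" "v \<in> verts E"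
  shows "(\<Oplus>p \<in> exit_paths E X v. path_elt v p \<otimes> ghost_elt v p) = vx v"
  using assms(1,2,4)
proof (induction v rule: acyclic_on_induct)
  case (outside v)
  then show ?case by (simp add: exit_paths_outside vx_idem)
next
  case (inside v)
  let ?t = "\<lambda>w p. path_elt w p \<otimes> ghost_elt w p"
  have t: "?t w p \<in> carrier R" if "p \<in> exit_paths E X w" for w p
    using that by (auto simp: exit_paths_def)
  have [simp]: "e \<in> out_arcs E v \<Longrightarrow> e \<in> arcs E" for e by simp
  have "(\<Oplus>p \<in> exit_paths E X v. ?t v p)
      = (\<Oplus>e \<in> out_arcs E v. \<Oplus>p \<in> (#) e ` exit_paths E X (head E e). ?t v p)"
    unfolding exit_paths_inside [OF inside(2)]
  proof (rule add.finprod_UN_disjoint)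
    show "?t v p \<in> carrier R"
      if "e \<in> out_arcs E v" "p \<in> (#) e ` exit_paths E X (head E e)" for e p
      using that inside(2) by (intro t) (auto simp: exit_paths_inside)
  qed (use inside(1) assms in \<open>auto simp: row_finite pairwise_def disjnt_def finite_exit_paths\<close>)
  also have "\<dots> = (\<Oplus>e \<in> out_arcs E v. ed e \<otimes> gh e)"
  proof (rule finsum_cong')
    fix e assume e: "e \<in> out_arcs E v"
    then have [simp]: "e \<in> arcs E" and h: "head E e \<in> verts E" by auto
    let ?T = "exit_paths E X (head E e)"
    have T: "finite ?T" using assms h by (intro finite_exit_paths)
    have "(\<Oplus>p \<in> (#) e ` ?T. ?t v p) = (\<Oplus>p \<in> ?T. ?t v (e # p))"
      using e inside(2) by (intro add.finprod_reindex) (auto intro!: t bexI [of _ e] simp: exit_paths_inside)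
    also have "\<dots> = (\<Oplus>p \<in> ?T. ed e \<otimes> ?t (head E e) p \<otimes> gh e)"
      using t by (intro finsum_cong') (auto simp: exit_paths_def m_assoc)
    also have "\<dots> = (\<Oplus>p \<in> ?T. ed e \<otimes> ?t (head E e) p) \<otimes> gh e"
      using t T by (intro finsum_ldistr [symmetric]) auto
    also have "(\<Oplus>p \<in> ?T. ed e \<otimes> ?t (head E e) p) = ed e \<otimes> (\<Oplus>p \<in> ?T. ?t (head E e) p)"
      using t T by (intro finsum_rdistr [symmetric]) auto
    also have "ed e \<otimes> (\<Oplus>p \<in> ?T. ?t (head E e) p) \<otimes> gh e = ed e \<otimes> gh e"
      using inside(3) [OF e] by (simp add: ed_head)
    finally show "(\<Oplus>p \<in> (#) e ` ?T. ?t v p) = ed e \<otimes> gh e" .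
  qed auto
  also have "\<dots> = vx v" using inside assms(3) by (simp add: ed_gh_sum)
  finally show ?case .
qed

lemma exit_paths_sum_Sigma:
  assumes X: "finite X" "acyclic_on E X" "\<And>v. v \<in> X \<Longrightarrow> out_arcs E v \<noteq> {}"
    and V: "finite V" "V \<subseteq> verts E"
  shows "(\<Oplus>a \<in> Sigma V (exit_paths E X). path_elt (fst a) (snd a) \<otimes> ghost_elt (fst a) (snd a))
    = (\<Oplus>v \<in> V. vx v)"
proof -
  let ?t = "\<lambda>a. path_elt (fst a) (snd a) \<otimes> ghost_elt (fst a) (snd a)"
  have t: "?t (v, p) \<in> carrier R" if "p \<in> exit_paths E X v" for v p
    using that by (auto simp: exit_paths_def)
  have "Sigma V (exit_paths E X) = (\<Union>v \<in> V. Pair v ` exit_paths E X v)" by auto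
  also have "(\<Oplus>a \<in> \<dots>. ?t a) = (\<Oplus>v \<in> V. \<Oplus>a \<in> Pair v ` exit_paths E X v. ?t a)"
    using V X t
    by (intro add.finprod_UN_disjoint) (auto simp: pairwise_def disjnt_def intro!: finite_exit_paths)
  also have "\<dots> = (\<Oplus>v \<in> V. vx v)"
  proof (rule finsum_cong')
    fix v assume v: "v \<in> V"
    have "(\<Oplus>a \<in> Pair v ` exit_paths E X v. ?t a) = (\<Oplus>p \<in> exit_paths E X v. ?t (v, p))"
      using t by (intro add.finprod_reindex) (auto simp: inj_on_def)
    then show "(\<Oplus>a \<in> Pair v ` exit_paths E X v. ?t a) = vx v"
      using exit_paths_sum [OF X] v V by auto
  qed (use V in auto)
  finally show ?thesis .
qed

end

section \<open>Orthogonal copies of sums of vertices\<close>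

context leavitt_family
begin

lemma vertex_sum_fixes:
  assumes "finite W" "W \<subseteq> verts E" "v \<in> W" "a \<in> carrier R" "vx v \<otimes> a = a"
  shows "(\<Oplus>w \<in> W. vx w) \<otimes> a = a"
proof -
  have [simp]: "w \<in> W \<Longrightarrow> vx w \<in> carrier R" for w using assms(2) by auto
  have "(\<Oplus>w \<in> W. vx w) \<otimes> a = (\<Oplus>w \<in> W. vx w \<otimes> a)"
    using assms by (intro finsum_ldistr) auto
  also have "\<dots> = vx v \<otimes> a"
  proof (rule finsum_only_term)
    fix w assume w: "w \<in> W" "w \<noteq> v"
    then have "vx w \<otimes> vx v = \<zero>" using assms by (intro vx_orth) auto
    moreover have "vx w \<otimes> (vx v \<otimes> a) = (vx w \<otimes> vx v) \<otimes> a"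
      using w assms by (simp add: m_assoc)
    ultimately show "vx w \<otimes> a = \<zero>" using assms by simp
  qed (use assms in auto)
  finally show ?thesis using assms(5) by simp
qed

text \<open>
  With \<open>\<mu>\<close> running over the exit paths from \<open>V\<close> and \<open>\<nu>\<close> denoting the path that replaces \<open>\<mu>\<close>, take
  \<open>x = \<Sum> \<mu> \<nu>\<^sup>*\<close> and \<open>y = \<Sum> \<nu> \<mu>\<^sup>*\<close>. The paths \<open>\<nu>\<close> are pairwise incomparable, so
  \<open>x y = \<Sum> \<mu> \<mu>\<^sup>* = p\<close>; they start outside \<open>V\<close>, so \<open>x p = p y = 0\<close>.
\<close>

lemma vertex_sum_orthogonal_copy:
  assumes cyclic: "\<forall>v \<in> verts E. lies_on_closed_simple_path E v \<longrightarrow> left_infinite E v"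
    and no_trace: "\<not> (\<exists>g. bounded_graph_trace E g \<and> (\<exists>v \<in> verts E. g v \<noteq> 0))"
    and V: "finite V" "V \<subseteq> verts E"
    and I: "ideal I R" "vx ` verts E \<subseteq> I"
  defines "p \<equiv> \<Oplus>v \<in> V. vx v"
  shows "\<exists>x \<in> I. \<exists>y \<in> I. x \<otimes> y = p \<and> x \<otimes> p = \<zero> \<and> p \<otimes> y = \<zero>"
proof -
  interpret I: ideal I R by (rule I(1))
  obtain X f where X: "finite X" "acyclic_on E X" "\<forall>v \<in> X. out_arcs E v \<noteq> {}"
    and f1: "\<forall>a \<in> Sigma V (exit_paths E X). fst (f a) \<in> verts E - V \<and>
      (\<exists>u. awalk (fst a) (snd a) u \<and> awalk (fst (f a)) (snd (f a)) u)"
    and f2: "\<forall>a \<in> Sigma V (exit_paths E X). \<forall>b \<in> Sigma V (exit_paths E X).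
      a \<noteq> b \<longrightarrow> fst (f a) = fst (f b) \<longrightarrow> (\<forall>r. snd (f a) @ r \<noteq> snd (f b))"
    using exit_paths_rerouted [OF cyclic no_trace V] by (elim exE conjE)
  define A where "A = Sigma V (exit_paths E X)"
  let ?end = "\<lambda>a. awlast (fst a) (snd a)"
  have W: "awalk (fst a) (snd a) (?end a)" "awalk (fst (f a)) (snd (f a)) (?end a)"
    "fst (f a) \<in> verts E - V" if a: "a \<in> A" for a
  proof -
    obtain u where "awalk (fst a) (snd a) u" "awalk (fst (f a)) (snd (f a)) u"
      "fst (f a) \<in> verts E - V"
      using bspec [OF f1 a [unfolded A_def]] by blast
    moreover from this(1) have "?end a = u" by (rule awlast_of_awalk) (simp add: NOMATCH_def)
    ultimately show "awalk (fst a) (snd a) (?end a)" "awalk (fst (f a)) (snd (f a)) (?end a)"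
      "fst (f a) \<in> verts E - V" by simp_all
  qed
  have A: "finite A" unfolding A_def using V X by (auto intro!: finite_SigmaI finite_exit_paths)
  define \<alpha> where "\<alpha> a = path_elt (fst a) (snd a)" for a
  define \<beta> where "\<beta> a = ghost_elt (fst a) (snd a)" for a
  define \<gamma> where "\<gamma> a = path_elt (fst (f a)) (snd (f a))" for a
  define \<delta> where "\<delta> a = ghost_elt (fst (f a)) (snd (f a))" for a
  have c: "\<alpha> a \<in> carrier R" "\<beta> a \<in> carrier R" "\<gamma> a \<in> carrier R" "\<delta> a \<in> carrier R" if "a \<in> A" for a
    unfolding \<alpha>_def \<beta>_def \<gamma>_def \<delta>_def
    using path_elt_closed [OF W(1) [OF that]] path_elt_closed [OF W(2) [OF that]]
      ghost_elt_closed [OF W(1) [OF that]] ghost_elt_closed [OF W(2) [OF that]] by simp_all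
  have vV [simp]: "vx v \<in> carrier R" if "v \<in> V" for v using V that by auto
  then have vPi: "vx \<in> V \<rightarrow> carrier R" by auto
  have p: "p \<in> carrier R" unfolding p_def by (rule finsum_closed) (rule vPi)
  have sum: "(\<Oplus>a \<in> A. \<alpha> a \<otimes> \<beta> a) = p"
    unfolding \<alpha>_def \<beta>_def p_def A_def using X V by (intro exit_paths_sum_Sigma) auto
  have diag: "\<alpha> a \<otimes> (\<delta> a \<otimes> \<gamma> a) = \<alpha> a" if "a \<in> A" for a
    unfolding \<alpha>_def \<gamma>_def \<delta>_def ghost_path_same [OF W(2) [OF that]]
    by (rule path_elt_end [OF W(1) [OF that]])
  have off: "\<delta> a \<otimes> \<gamma> b = \<zero>" if ab: "a \<in> A" "b \<in> A" "a \<noteq> b" for a b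
  proof (cases "fst (f a) = fst (f b)")
    case True
    have "snd (f a) @ r \<noteq> snd (f b)" "snd (f b) @ r \<noteq> snd (f a)" for r
      using f2 ab True unfolding A_def [symmetric] by metis+
    then show ?thesis
      unfolding \<gamma>_def \<delta>_def using W(2) [OF ab(1)] W(2) [OF ab(2)] True
      by (metis ghost_path_incomparable)
  next
    case False
    then show ?thesis
      unfolding \<gamma>_def \<delta>_def using W(2) [OF ab(1)] W(2) [OF ab(2)]
      by (intro ghost_path_start_orth)
  qed
  have "\<delta> a \<otimes> p = \<zero>" if a: "a \<in> A" for a
  proof -
    have "\<delta> a \<otimes> p = (\<Oplus>v \<in> V. \<delta> a \<otimes> vx v)"
      unfolding p_def using V c [OF a] by (intro finsum_rdistr) auto
    also have "\<dots> = \<zero>"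
      unfolding \<delta>_def using V W(3) [OF a]
      by (intro finsum_all_zero ghost_vx_orth [OF W(2) [OF a]]) auto
    finally show ?thesis .
  qed
  moreover have "p \<otimes> \<gamma> a = \<zero>" if a: "a \<in> A" for a
  proof -
    have "p \<otimes> \<gamma> a = (\<Oplus>v \<in> V. vx v \<otimes> \<gamma> a)"
      unfolding p_def using V c [OF a] by (intro finsum_ldistr) auto
    also have "\<dots> = \<zero>"
      unfolding \<gamma>_def using V W(3) [OF a]
      by (intro finsum_all_zero vx_path_orth [OF W(2) [OF a]]) auto
    finally show ?thesis .
  qed
  ultimately have copy: "(\<Oplus>a \<in> A. \<alpha> a \<otimes> \<delta> a) \<otimes> (\<Oplus>a \<in> A. \<gamma> a \<otimes> \<beta> a) = p"
    "(\<Oplus>a \<in> A. \<alpha> a \<otimes> \<delta> a) \<otimes> p = \<zero>" "p \<otimes> (\<Oplus>a \<in> A. \<gamma> a \<otimes> \<beta> a) = \<zero>"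
    using orthogonal_copy [OF A, of \<alpha> \<beta> \<gamma> \<delta> p] c p sum diag off by blast+
  \<comment> \<open>Path elements lie in the ideal because they are multiples of the vertex at their end.\<close>
  have inI: "path_elt v q \<in> I" if "awalk v q w" for v q w
  proof -
    have "path_elt v q \<otimes> vx w \<in> I"
      using I(2) awalk_last_in_verts [OF that] path_elt_closed [OF that] by (auto intro: I.I_l_closed)
    then show ?thesis using path_elt_end [OF that] by simp
  qed
  have "(\<Oplus>a \<in> A. \<alpha> a \<otimes> \<delta> a) \<in> I" "(\<Oplus>a \<in> A. \<gamma> a \<otimes> \<beta> a) \<in> I"
    using c inI [OF W(1)] inI [OF W(2)] unfolding \<alpha>_def \<gamma>_def
    by (auto intro!: ideal_finsum_closed [OF I(1)] I.I_r_closed)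
  with copy show ?thesis by blast
qed

end

section \<open>The Leavitt path algebra\<close>

lemma (in ring_hom_ring) hom_finsum_ring:
  assumes "f \<in> A \<rightarrow> carrier R"
  shows "h (finsum R f A) = (\<Oplus>\<^bsub>S\<^esub>a \<in> A. h (f a))"
  using assms by (induction A rule: infinite_finite_induct) (auto simp: Pi_def)

abbreviation leavitt_class ::
  "('k, 'm) ring_scheme \<Rightarrow> ('v, 'e) pre_digraph \<Rightarrow> (('v, 'e) leavitt_gen list \<Rightarrow> 'k) \<Rightarrow>
    (('v, 'e) leavitt_gen list \<Rightarrow> 'k) set" where
  "leavitt_class K E f \<equiv> leavitt_ideal K E +>\<^bsub>leavitt_free K E\<^esub> f"

lemma leavitt_class_hom:
  assumes "field K" "wf_digraph E"
  shows "ring_hom_ring (leavitt_free K E) (leavitt_unitization K E) (leavitt_class K E)"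
proof -
  interpret field K by fact
  interpret F: ring "leavitt_free K E" by (rule ring_free_algebra)
  have I: "ideal (leavitt_ideal K E) (leavitt_free K E)"
    unfolding leavitt_ideal_def by (intro F.genideal_ideal leavitt_relations_subset assms)
  then show ?thesis
    unfolding leavitt_unitization_def by (rule ideal.rcos_ring_hom_ring)
qed

lemma leavitt_class_relation:
  assumes "field K" "wf_digraph E" "f \<in> leavitt_relations K E"
  shows "leavitt_class K E f = \<zero>\<^bsub>leavitt_unitization K E\<^esub>"
proof -
  interpret field K by fact
  interpret F: ring "leavitt_free K E" by (rule ring_free_algebra)
  interpret I: ideal "leavitt_ideal K E" "leavitt_free K E"
    unfolding leavitt_ideal_def by (intro F.genideal_ideal leavitt_relations_subset assms)
  have "f \<in> leavitt_ideal K E"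
    unfolding leavitt_ideal_def
    using F.genideal_self [OF leavitt_relations_subset [OF assms(1,2)]] assms(3) by auto
  then show ?thesis
    by (simp add: I.a_rcos_const leavitt_unitization_def FactRing_def)
qed

lemma leavitt_family_unitization:
  assumes K: "field K" and E: "row_finite_graph E"
  shows "leavitt_family (leavitt_unitization K E) E
    (\<lambda>v. leavitt_class K E (free_var K (Vertex v)))
    (\<lambda>e. leavitt_class K E (free_var K (Edge e)))
    (\<lambda>e. leavitt_class K E (free_var K (Ghost e)))"
proof -
  interpret field K by fact
  interpret row_finite_graph E by fact
  interpret h: ring_hom_ring "leavitt_free K E" "leavitt_unitization K E" "leavitt_class K E"
    using K wf_digraph_axioms by (rule leavitt_class_hom)
  have gen [simp]: "v \<in> verts E \<Longrightarrow> free_var K (Vertex v) \<in> carrier (leavitt_free K E)"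
    "e \<in> arcs E \<Longrightarrow> free_var K (Edge e) \<in> carrier (leavitt_free K E)"
    "e \<in> arcs E \<Longrightarrow> free_var K (Ghost e) \<in> carrier (leavitt_free K E)" for v e
    by (auto intro!: free_var_closed K simp: leavitt_gens_def)
  have zero: "leavitt_class K E f = \<zero>\<^bsub>leavitt_unitization K E\<^esub>" if "f \<in> leavitt_relations K E" for f
    using K wf_digraph_axioms that by (rule leavitt_class_relation)
  have eq: "leavitt_class K E f = leavitt_class K E g"
    if "f \<ominus>\<^bsub>leavitt_free K E\<^esub> g \<in> leavitt_relations K E"
      "f \<in> carrier (leavitt_free K E)" "g \<in> carrier (leavitt_free K E)" for f g
  proof -
    have "leavitt_class K E f \<ominus>\<^bsub>leavitt_unitization K E\<^esub> leavitt_class K E g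
        = leavitt_class K E (f \<ominus>\<^bsub>leavitt_free K E\<^esub> g)"
      using that by (simp add: a_minus_def)
    also have "\<dots> = \<zero>\<^bsub>leavitt_unitization K E\<^esub>" using that by (simp add: zero)
    finally have "\<ominus>\<^bsub>leavitt_unitization K E\<^esub> (\<ominus>\<^bsub>leavitt_unitization K E\<^esub> leavitt_class K E g)
        = leavitt_class K E f"
      using that by (intro h.S.minus_equality) (simp_all add: a_minus_def)
    then show ?thesis using that by simp
  qed
  have mult: "leavitt_class K E f \<otimes>\<^bsub>leavitt_unitization K E\<^esub> leavitt_class K E g
      = leavitt_class K E (f \<otimes>\<^bsub>leavitt_free K E\<^esub> g)"
    if "f \<in> carrier (leavitt_free K E)" "g \<in> carrier (leavitt_free K E)" for f g
    using that by simp
  have mult_zero: "leavitt_class K E f \<otimes>\<^bsub>leavitt_unitization K E\<^esub> leavitt_class K E g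
      = \<zero>\<^bsub>leavitt_unitization K E\<^esub>"
    if "f \<otimes>\<^bsub>leavitt_free K E\<^esub> g \<in> leavitt_relations K E"
      "f \<in> carrier (leavitt_free K E)" "g \<in> carrier (leavitt_free K E)" for f g
    unfolding mult [OF that(2,3)] by (rule zero [OF that(1)])
  have mult_eq: "leavitt_class K E f \<otimes>\<^bsub>leavitt_unitization K E\<^esub> leavitt_class K E g
      = leavitt_class K E k"
    if "f \<otimes>\<^bsub>leavitt_free K E\<^esub> g \<ominus>\<^bsub>leavitt_free K E\<^esub> k \<in> leavitt_relations K E"
      "f \<in> carrier (leavitt_free K E)" "g \<in> carrier (leavitt_free K E)"
      "k \<in> carrier (leavitt_free K E)" for f g k
    unfolding mult [OF that(2,3)] using that by (intro eq) auto
  show ?thesis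
  proof (unfold_locales, goal_cases)
    case (5 v w)
    then show ?case by (intro mult_zero) (auto simp: leavitt_relations_def Let_def)
  next
    case (11 e f)
    then show ?case by (intro mult_zero) (auto simp: leavitt_relations_def Let_def)
  next
    case (12 v)
    let ?s = "\<Oplus>\<^bsub>leavitt_free K E\<^esub>e \<in> out_arcs E v.
      free_var K (Edge e) \<otimes>\<^bsub>leavitt_free K E\<^esub> free_var K (Ghost e)"
    have c: "(\<lambda>e. free_var K (Edge e) \<otimes>\<^bsub>leavitt_free K E\<^esub> free_var K (Ghost e))
        \<in> out_arcs E v \<rightarrow> carrier (leavitt_free K E)" by auto
    have "leavitt_class K E (free_var K (Vertex v)) = leavitt_class K E ?s"
      using 12 h.R.finsum_closed [OF c]
      by (intro eq) (auto simp: leavitt_relations_def Let_def)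
    also have "\<dots> = (\<Oplus>\<^bsub>leavitt_unitization K E\<^esub>e \<in> out_arcs E v. leavitt_class K E
        (free_var K (Edge e) \<otimes>\<^bsub>leavitt_free K E\<^esub> free_var K (Ghost e)))"
      by (rule h.hom_finsum_ring [OF c])
    also have "\<dots> = (\<Oplus>\<^bsub>leavitt_unitization K E\<^esub>e \<in> out_arcs E v.
        leavitt_class K E (free_var K (Edge e)) \<otimes>\<^bsub>leavitt_unitization K E\<^esub>
        leavitt_class K E (free_var K (Ghost e)))"
      by (intro h.S.finsum_cong') auto
    finally show ?case .
  qed (simp, simp, simp, (intro mult_eq; auto simp: leavitt_relations_def Let_def)+)
qed


lemma leavitt_carrier_ideal:
  assumes "field K" "wf_digraph E"
  shows "ideal (carrier (leavitt_path_algebra K E)) (leavitt_unitization K E)"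
  using embeds_leavitt_unitization [OF assms] by (simp add: embeds_as_ideal_def)

text \<open>
  Splitting off the words that begin with \<open>x\<close> allows an induction on the set of first letters of an
  element.
\<close>

lemma free_algebra_first_letter:
  assumes "ring K" and f: "f \<in> carrier (free_algebra K X)" and x: "x \<in> X"
  defines "tail_part \<equiv> \<lambda>w. f (x # w)"
    and "rest \<equiv> \<lambda>w. if w \<noteq> [] \<and> hd w = x then \<zero>\<^bsub>K\<^esub> else f w"
  shows "tail_part \<in> carrier (free_algebra K X)" "rest \<in> carrier (free_algebra K X)"
    and "f = free_var K x \<otimes>\<^bsub>free_algebra K X\<^esub> tail_part \<oplus>\<^bsub>free_algebra K X\<^esub> rest"
proof -
  interpret ring K by fact
  have c [simp]: "f w \<in> carrier K" for w using f by (simp add: free_algebra_simps)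
  have "finite ((#) x -` {w. f w \<noteq> \<zero>\<^bsub>K\<^esub>})"
    using f by (intro finite_vimageI) (auto simp: free_algebra_simps)
  moreover have "(#) x -` {w. f w \<noteq> \<zero>\<^bsub>K\<^esub>} = {w. tail_part w \<noteq> \<zero>\<^bsub>K\<^esub>}"
    by (auto simp: tail_part_def)
  moreover have "w \<in> lists X" if "tail_part w \<noteq> \<zero>\<^bsub>K\<^esub>" for w
  proof -
    have "x # w \<in> lists X" using f that unfolding free_algebra_simps(1) tail_part_def by blast
    then show ?thesis by simp
  qed
  ultimately show tail: "tail_part \<in> carrier (free_algebra K X)"
    unfolding free_algebra_simps(1) by (auto simp: tail_part_def)
  have "{w. rest w \<noteq> \<zero>\<^bsub>K\<^esub>} \<subseteq> {w. f w \<noteq> \<zero>\<^bsub>K\<^esub>}" by (auto simp: rest_def)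
  moreover have "finite {w. f w \<noteq> \<zero>\<^bsub>K\<^esub>}" "{w. f w \<noteq> \<zero>\<^bsub>K\<^esub>} \<subseteq> lists X"
    using f by (simp_all add: free_algebra_simps(1))
  ultimately have "finite {w. rest w \<noteq> \<zero>\<^bsub>K\<^esub>}" "{w. rest w \<noteq> \<zero>\<^bsub>K\<^esub>} \<subseteq> lists X"
    by (auto dest: finite_subset)
  moreover have "rest w \<in> carrier K" for w by (simp add: rest_def)
  ultimately show "rest \<in> carrier (free_algebra K X)" by (simp add: free_algebra_simps(1))
  have v: "free_var K x w \<in> carrier K" for w by (simp add: free_var_def)
  have t: "tail_part w \<in> carrier K" for w by (simp add: tail_part_def)
  have "f w = conv (free_var K x) tail_part w \<oplus>\<^bsub>K\<^esub> rest w" for w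
  proof (cases w)
    case Nil
    then show ?thesis using v t by (simp add: free_var_def rest_def)
  next
    case (Cons y u)
    have "(\<lambda>u. free_var K x (y # u)) =
        (if y = x then (\<lambda>w. if w = [] then \<one>\<^bsub>K\<^esub> else \<zero>\<^bsub>K\<^esub>) else (\<lambda>w. \<zero>\<^bsub>K\<^esub>))"
      by (auto simp: free_var_def)
    moreover have "free_var K x [] = \<zero>\<^bsub>K\<^esub>" by (simp add: free_var_def)
    ultimately have "conv (free_var K x) tail_part w = (if y = x then tail_part u else \<zero>\<^bsub>K\<^esub>)"
      using v t by (simp add: Cons conv_Cons conv_one_left conv_zero_left)
    then show ?thesis by (simp add: Cons rest_def tail_part_def)
  qed
  then show "f = free_var K x \<otimes>\<^bsub>free_algebra K X\<^esub> tail_part \<oplus>\<^bsub>free_algebra K X\<^esub> rest"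
    by (auto simp: free_algebra_mult free_algebra_simps(5))
qed

text \<open>
  Each generator is fixed on the left by a vertex, and the product of an element with a generator on
  its left is fixed by the same vertex. Asking for all larger sets \<open>W\<close> lets the units of
  several elements be combined.
\<close>

lemma leavitt_left_units:
  assumes K: "field K" and E: "row_finite_graph E"
    and r: "r \<in> carrier (leavitt_path_algebra K E)"
  shows "\<exists>V. finite V \<and> V \<subseteq> verts E \<and> (\<forall>W. finite W \<longrightarrow> V \<subseteq> W \<longrightarrow> W \<subseteq> verts E \<longrightarrow>
    (\<Oplus>\<^bsub>leavitt_unitization K E\<^esub>v \<in> W. leavitt_class K E (free_var K (Vertex v)))
      \<otimes>\<^bsub>leavitt_unitization K E\<^esub> r = r)"
proof -
  interpret field K by fact
  interpret row_finite_graph E by fact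
  let ?F = "leavitt_free K E" and ?Q = "leavitt_unitization K E" and ?q = "leavitt_class K E"
  interpret h: ring_hom_ring ?F ?Q ?q
    using K wf_digraph_axioms by (rule leavitt_class_hom)
  interpret L: leavitt_family ?Q E "\<lambda>v. ?q (free_var K (Vertex v))"
    "\<lambda>e. ?q (free_var K (Edge e))" "\<lambda>e. ?q (free_var K (Ghost e))"
    using K E by (rule leavitt_family_unitization)
  let ?p = "\<lambda>W. \<Oplus>\<^bsub>?Q\<^esub>v \<in> W. ?q (free_var K (Vertex v))"
  define unit where "unit V f \<longleftrightarrow> finite V \<and> V \<subseteq> verts E \<and>
    (\<forall>W. finite W \<longrightarrow> V \<subseteq> W \<longrightarrow> W \<subseteq> verts E \<longrightarrow> ?p W \<otimes>\<^bsub>?Q\<^esub> ?q f = ?q f)" for V f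
  have p: "?p W \<in> carrier ?Q" if "W \<subseteq> verts E" for W
    using that by (intro h.S.finsum_closed) auto
  \<comment> \<open>The three cases use \<open>v v = v\<close>, \<open>s(e) e = e\<close> and \<open>r(e) e\<^sup>* = e\<^sup>*\<close>.\<close>
  have gen: "\<exists>v \<in> verts E. ?q (free_var K (Vertex v)) \<otimes>\<^bsub>?Q\<^esub> ?q (free_var K x) = ?q (free_var K x)"
    if x: "x \<in> leavitt_gens E" for x
  proof -
    consider v where "v \<in> verts E" "x = Vertex v" | e where "e \<in> arcs E" "x = Edge e"
      | e where "e \<in> arcs E" "x = Ghost e"
      using x unfolding leavitt_gens_def by blast
    then show ?thesis
      using L.vx_idem L.tail_ed L.head_gh tail_in_verts head_in_verts by cases blast+
  qed
  have letters: "\<exists>V. unit V f"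
    if "finite Z" "f \<in> free_algebra_plus K (leavitt_gens E)" "hd ` {w. f w \<noteq> \<zero>\<^bsub>K\<^esub>} \<subseteq> Z"
      "Z \<subseteq> leavitt_gens E" for Z f
    using that
  proof (induction Z arbitrary: f)
    case empty
    then have "f = \<zero>\<^bsub>?F\<^esub>" by (auto simp: free_algebra_simps)
    then have "unit {} f" using p by (simp add: unit_def)
    then show ?case by blast
  next
    case (insert x Z)
    define t where "t = (\<lambda>w. f (x # w))"
    define g where "g = (\<lambda>w. if w \<noteq> [] \<and> hd w = x then \<zero>\<^bsub>K\<^esub> else f w)"
    have f: "f \<in> carrier ?F" "f [] = \<zero>\<^bsub>K\<^esub>" and x: "x \<in> leavitt_gens E"
      using insert.prems by (auto simp: free_algebra_plus_def)
    note split = free_algebra_first_letter [OF ring_axioms f(1) x, folded t_def g_def]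
    have xF: "free_var K x \<in> carrier ?F" using K x by (rule free_var_closed)
    have "g \<in> free_algebra_plus K (leavitt_gens E)"
      using split(2) f(2) by (simp add: free_algebra_plus_def g_def)
    moreover have "hd ` {w. g w \<noteq> \<zero>\<^bsub>K\<^esub>} \<subseteq> Z"
    proof (intro image_subsetI)
      fix w assume "w \<in> {w. g w \<noteq> \<zero>\<^bsub>K\<^esub>}"
      then have "f w \<noteq> \<zero>\<^bsub>K\<^esub>" "w = [] \<or> hd w \<noteq> x" by (auto simp: g_def split: if_splits)
      then show "hd w \<in> Z" using insert.prems(2) f(2) by auto
    qed
    ultimately have "\<exists>V. unit V g" using insert.prems(3) by (intro insert.IH) auto
    then obtain V where V: "unit V g" by blast
    obtain v where v: "v \<in> verts E"
      "?q (free_var K (Vertex v)) \<otimes>\<^bsub>?Q\<^esub> ?q (free_var K x) = ?q (free_var K x)"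
      using gen [OF x] by blast
    have qf: "?q f = ?q (free_var K x) \<otimes>\<^bsub>?Q\<^esub> ?q t \<oplus>\<^bsub>?Q\<^esub> ?q g"
      using arg_cong [OF split(3), of ?q] split(1,2) xF by simp
    have "?p W \<otimes>\<^bsub>?Q\<^esub> ?q f = ?q f"
      if W: "finite W" "insert v V \<subseteq> W" "W \<subseteq> verts E" for W
    proof -
      have "?p W \<otimes>\<^bsub>?Q\<^esub> ?q (free_var K x) = ?q (free_var K x)"
        using W v xF by (intro L.vertex_sum_fixes) auto
      moreover have "?p W \<otimes>\<^bsub>?Q\<^esub> ?q g = ?q g" using V W by (simp add: unit_def)
      ultimately show ?thesis
        unfolding qf using p [OF W(3)] split(1,2) xF
        by (simp add: h.S.r_distr h.S.m_assoc [symmetric])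
    qed
    then have "unit (insert v V) f" using V v(1) by (simp add: unit_def)
    then show ?case by blast
  qed
  obtain f where f: "f \<in> free_algebra_plus K (leavitt_gens E)" "r = ?q f"
    using r by (auto simp: leavitt_path_algebra_def)
  then have fin: "finite {w. f w \<noteq> \<zero>\<^bsub>K\<^esub>}" "{w. f w \<noteq> \<zero>\<^bsub>K\<^esub>} \<subseteq> lists (leavitt_gens E)"
    "f [] = \<zero>\<^bsub>K\<^esub>"
    by (auto simp: free_algebra_plus_def free_algebra_simps)
  have "hd w \<in> leavitt_gens E" if "f w \<noteq> \<zero>\<^bsub>K\<^esub>" for w
    using that fin by (cases w) auto
  then have "\<exists>V. unit V f" using f(1) fin(1) by (intro letters [of "hd ` {w. f w \<noteq> \<zero>\<^bsub>K\<^esub>}"]) auto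
  then show ?thesis unfolding unit_def f(2) .
qed

lemma leavitt_orthogonal_copies:
  assumes K: "field K" and E: "row_finite_graph E"
    and cyclic: "\<forall>v \<in> verts E. lies_on_closed_simple_path E v \<longrightarrow> left_infinite E v"
    and no_trace: "\<not> (\<exists>g. bounded_graph_trace E g \<and> (\<exists>v \<in> verts E. g v \<noteq> 0))"
    and bc: "b \<in> carrier (leavitt_path_algebra K E)" "c \<in> carrier (leavitt_path_algebra K E)"
  shows "\<exists>p \<in> carrier (leavitt_path_algebra K E). \<exists>x \<in> carrier (leavitt_path_algebra K E).
    \<exists>y \<in> carrier (leavitt_path_algebra K E).
      p \<otimes>\<^bsub>leavitt_path_algebra K E\<^esub> b = b \<and> p \<otimes>\<^bsub>leavitt_path_algebra K E\<^esub> c = c \<and>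
      x \<otimes>\<^bsub>leavitt_path_algebra K E\<^esub> y = p \<and>
      x \<otimes>\<^bsub>leavitt_path_algebra K E\<^esub> p = \<zero>\<^bsub>leavitt_path_algebra K E\<^esub> \<and>
      p \<otimes>\<^bsub>leavitt_path_algebra K E\<^esub> y = \<zero>\<^bsub>leavitt_path_algebra K E\<^esub>"
proof -
  interpret row_finite_graph E by fact
  let ?Q = "leavitt_unitization K E" and ?q = "leavitt_class K E"
  let ?L = "carrier (leavitt_path_algebra K E)"
  interpret L: leavitt_family ?Q E "\<lambda>v. ?q (free_var K (Vertex v))"
    "\<lambda>e. ?q (free_var K (Edge e))" "\<lambda>e. ?q (free_var K (Ghost e))"
    using K E by (rule leavitt_family_unitization)
  have I: "ideal ?L ?Q" using K wf_digraph_axioms by (rule leavitt_carrier_ideal)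
  have ops: "monoid.mult (leavitt_path_algebra K E) = monoid.mult ?Q"
    "ring.zero (leavitt_path_algebra K E) = ring.zero ?Q"
    by (simp_all add: leavitt_path_algebra_def)
  have vxL: "(\<lambda>v. ?q (free_var K (Vertex v))) ` verts E \<subseteq> ?L"
  proof (intro image_subsetI)
    fix v assume "v \<in> verts E"
    then have "free_var K (Vertex v) \<in> free_algebra_plus K (leavitt_gens E)"
      using free_var_closed [OF K, of "Vertex v" "leavitt_gens E"]
      by (auto simp: free_algebra_plus_def free_var_def leavitt_gens_def)
    then show "?q (free_var K (Vertex v)) \<in> ?L" by (auto simp: leavitt_path_algebra_def)
  qed
  let ?p = "\<lambda>W. \<Oplus>\<^bsub>?Q\<^esub>v \<in> W. ?q (free_var K (Vertex v))"
  obtain V where V: "finite V" "V \<subseteq> verts E"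
    and unit_b: "\<forall>W. finite W \<longrightarrow> V \<subseteq> W \<longrightarrow> W \<subseteq> verts E \<longrightarrow> ?p W \<otimes>\<^bsub>?Q\<^esub> b = b"
    using leavitt_left_units [OF K E bc(1)] by (elim exE conjE)
  obtain V' where V': "finite V'" "V' \<subseteq> verts E"
    and unit_c: "\<forall>W. finite W \<longrightarrow> V' \<subseteq> W \<longrightarrow> W \<subseteq> verts E \<longrightarrow> ?p W \<otimes>\<^bsub>?Q\<^esub> c = c"
    using leavitt_left_units [OF K E bc(2)] by (elim exE conjE)
  have W: "finite (V \<union> V')" "V \<union> V' \<subseteq> verts E" using V V' by simp_all
  have "?p (V \<union> V') \<in> ?L" using vxL W(2) by (intro L.ideal_finsum_closed [OF I]) blast
  moreover have "?p (V \<union> V') \<otimes>\<^bsub>?Q\<^esub> b = b" "?p (V \<union> V') \<otimes>\<^bsub>?Q\<^esub> c = c"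
    using W unit_b unit_c by simp_all
  moreover obtain x y where "x \<in> ?L" "y \<in> ?L" "x \<otimes>\<^bsub>?Q\<^esub> y = ?p (V \<union> V')"
    "x \<otimes>\<^bsub>?Q\<^esub> ?p (V \<union> V') = \<zero>\<^bsub>?Q\<^esub>" "?p (V \<union> V') \<otimes>\<^bsub>?Q\<^esub> y = \<zero>\<^bsub>?Q\<^esub>"
    using L.vertex_sum_orthogonal_copy [OF cyclic no_trace W I vxL] by (elim bexE conjE)
  ultimately show ?thesis
    unfolding ops by (intro bexI [of _ "?p (V \<union> V')"] bexI [of _ x] bexI [of _ y] conjI)
qed

theorem corollary6p8:
  fixes K :: "('k, 'm) ring_scheme"
    and E :: "('v, 'e) pre_digraph"
    and S :: "('s, 'n) ring_scheme"
    and \<phi> :: "(('v, 'e) leavitt_gen list \<Rightarrow> 'k) set \<Rightarrow> 's"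
  assumes "field K"
    and "row_finite_graph E"
    and "\<forall>v \<in> verts E. lies_on_closed_simple_path E v \<longrightarrow> left_infinite E v"
    and "\<not> (\<exists>g. bounded_graph_trace E g \<and> (\<exists>v \<in> verts E. g v \<noteq> 0))"
    and "embeds_as_ideal (leavitt_path_algebra K E) S \<phi>"
  shows "stable_rank S (\<phi> ` carrier (leavitt_path_algebra K E)) \<le> 2"
proof -
  let ?A = "leavitt_path_algebra K E"
  let ?L = "carrier ?A"
  interpret row_finite_graph E by fact
  interpret Q: ideal ?L "leavitt_unitization K E"
    using assms(1) wf_digraph_axioms by (rule leavitt_carrier_ideal)
  have \<phi>: "\<phi> \<in> hom (add_monoid ?A) (add_monoid S)" "\<phi> \<in> hom ?A S" "ideal (\<phi> ` ?L) S"
    using assms(5) by (auto simp: embeds_as_ideal_def)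
  interpret I: ideal "\<phi> ` ?L" S by (rule \<phi>(3))
  have mult: "\<phi> (a \<otimes>\<^bsub>?A\<^esub> b) = \<phi> a \<otimes>\<^bsub>S\<^esub> \<phi> b" if "a \<in> ?L" "b \<in> ?L" for a b
    using \<phi>(2) that by (simp add: hom_def)
  have ops: "\<zero>\<^bsub>?A\<^esub> = \<zero>\<^bsub>leavitt_unitization K E\<^esub>"
    "(\<oplus>\<^bsub>?A\<^esub>) = (\<oplus>\<^bsub>leavitt_unitization K E\<^esub>)"
    by (simp_all add: leavitt_path_algebra_def)
  have zeroL: "\<zero>\<^bsub>?A\<^esub> \<in> ?L" "\<zero>\<^bsub>?A\<^esub> \<oplus>\<^bsub>?A\<^esub> \<zero>\<^bsub>?A\<^esub> = \<zero>\<^bsub>?A\<^esub>"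
    unfolding ops using additive_subgroup.zero_closed [OF Q.is_additive_subgroup] by simp_all
  have z: "\<phi> \<zero>\<^bsub>?A\<^esub> \<in> carrier S" using zeroL(1) I.Icarr by blast
  have "\<phi> (\<zero>\<^bsub>?A\<^esub> \<oplus>\<^bsub>?A\<^esub> \<zero>\<^bsub>?A\<^esub>) = \<phi> \<zero>\<^bsub>?A\<^esub> \<oplus>\<^bsub>S\<^esub> \<phi> \<zero>\<^bsub>?A\<^esub>"
    using \<phi>(1) zeroL(1) by (simp add: hom_def)
  then have "\<phi> \<zero>\<^bsub>?A\<^esub> \<oplus>\<^bsub>S\<^esub> \<phi> \<zero>\<^bsub>?A\<^esub> = \<phi> \<zero>\<^bsub>?A\<^esub>" unfolding zeroL(2) by (rule sym)
  then have zero: "\<phi> \<zero>\<^bsub>?A\<^esub> = \<zero>\<^bsub>S\<^esub>" using I.add.l_cancel_one [OF z z] by simp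
  have "in_stable_range S (\<phi> ` ?L) 2"
  proof (rule I.in_stable_range_2_if_orthogonal_copies [OF \<phi>(3)])
    fix b' c' assume "b' \<in> \<phi> ` ?L" "c' \<in> \<phi> ` ?L"
    then obtain b c where bc: "b \<in> ?L" "c \<in> ?L" and [simp]: "b' = \<phi> b" "c' = \<phi> c" by blast
    obtain p x y where L: "p \<in> ?L" "x \<in> ?L" "y \<in> ?L"
      and "p \<otimes>\<^bsub>?A\<^esub> b = b" "p \<otimes>\<^bsub>?A\<^esub> c = c" "x \<otimes>\<^bsub>?A\<^esub> y = p"
        "x \<otimes>\<^bsub>?A\<^esub> p = \<zero>\<^bsub>?A\<^esub>" "p \<otimes>\<^bsub>?A\<^esub> y = \<zero>\<^bsub>?A\<^esub>"
      using leavitt_orthogonal_copies [OF assms(1-4) bc] by blast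
    then have "\<phi> p \<otimes>\<^bsub>S\<^esub> b' = b' \<and> \<phi> p \<otimes>\<^bsub>S\<^esub> c' = c' \<and> \<phi> x \<otimes>\<^bsub>S\<^esub> \<phi> y = \<phi> p \<and>
        \<phi> x \<otimes>\<^bsub>S\<^esub> \<phi> p = \<zero>\<^bsub>S\<^esub> \<and> \<phi> p \<otimes>\<^bsub>S\<^esub> \<phi> y = \<zero>\<^bsub>S\<^esub>"
      using bc zero by (simp flip: mult)
    with L show "\<exists>p \<in> \<phi> ` ?L. \<exists>x \<in> \<phi> ` ?L. \<exists>y \<in> \<phi> ` ?L.
        p \<otimes>\<^bsub>S\<^esub> b' = b' \<and> p \<otimes>\<^bsub>S\<^esub> c' = c' \<and> x \<otimes>\<^bsub>S\<^esub> y = p \<and>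
        x \<otimes>\<^bsub>S\<^esub> p = \<zero>\<^bsub>S\<^esub> \<and> p \<otimes>\<^bsub>S\<^esub> y = \<zero>\<^bsub>S\<^esub>" by blast
  qed
  then have "stable_rank S (\<phi> ` ?L) \<le> enat 2"
    unfolding stable_rank_def by (intro Inf_lower) force
  then show ?thesis by (simp add: numeral_eq_enat)
qed

end
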